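(* Let $H$ be a separable infinite-dimensional complex Hilbert space, let $p\ge1$, and let $\alpha:\mathbb{N}_0\to[0,\infty)$ be a monotone increasing function with $\alpha(0)=0$ and $\alpha(1)>0$. Put $c_i:=\alpha(i)-\alpha(i-1)$ for $i=1,2,\dots$, let $\varphi_\alpha$ be the non-linear trace of Choquet type associated with $\alpha$, and define $|||a|||_{\alpha,p}:=\varphi_\alpha(|a|^p)^{1/p}\in[0,\infty]$ for $a\in K(H)$. Then the following conditions are equivalent: (1) $\alpha$ is concave in the sense that $\frac{\alpha(i+1)+\alpha(i-1)}{2}\le\alpha(i)$ for $i=1,2,3,\dots$. (2) $(c_i)_i$ is a decreasing sequence: $c_1\ge c_2\ge\cdots\ge c_n\ge\cdots$. (3) $|||\cdot|||_{\alpha,p}$ satisfies the triangle inequality: for any $a,b\in K(H)$, $|||a+b|||_{\alpha,p}\le|||a|||_{\alpha,p}+|||b|||_{\alpha,p}$, admitting the value $+\infty$.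
   Context: $\mathbb{N}_0=\{0,1,2,\dots\}$; $K(H)$ is the algebra of compact operators on $H$, $K(H)^+$ its positive elements, $|a|=(a^*a)^{1/2}$. For $a\in K(H)^+$, $\lambda_1(a)\ge\lambda_2(a)\ge\cdots$ denotes the sequence of nonzero eigenvalues of $a$ in decreasing order counted with multiplicity (completed by zeros if $a$ has finite rank). The non-linear trace of Choquet type associated with $\alpha$ is $\varphi_\alpha:K(H)^+\to[0,\infty]$, $\varphi_\alpha(a)=\sum_{i=1}^\infty(\lambda_i(a)-\lambda_{i+1}(a))\alpha(i)$, which also equals $\sum_{i=1}^\infty c_i\lambda_i(a)$. *)

theory Defs
  imports "HOL-Analysis.Analysis"
begin

text \<open>
  Complex Hilbert spaces. The Banach space structure (and hence the topology and completeness)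
  is inherited; the inner product is linear in its first argument and induces the norm.
\<close>

class complex_hilbert_space = banach +
  fixes scaleC :: "complex \<Rightarrow> 'a \<Rightarrow> 'a" (infixr "*\<^sub>C" 75)
    and cinner :: "'a \<Rightarrow> 'a \<Rightarrow> complex"
  assumes scaleC_add_right: "a *\<^sub>C (x + y) = a *\<^sub>C x + a *\<^sub>C y"
    and scaleC_add_left: "(a + b) *\<^sub>C x = a *\<^sub>C x + b *\<^sub>C x"
    and scaleC_scaleC: "a *\<^sub>C (b *\<^sub>C x) = (a * b) *\<^sub>C x"
    and scaleC_of_real: "complex_of_real r *\<^sub>C x = r *\<^sub>R x"
    and cinner_add_left: "cinner (x + y) z = cinner x z + cinner y z"
    and cinner_scaleC_left: "cinner (a *\<^sub>C x) y = a * cinner x y"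
    and cinner_commute: "cinner x y = cnj (cinner y x)"
    and cinner_self: "cinner x x = complex_of_real ((norm x)\<^sup>2)"

global_interpretation cvec: vector_space "scaleC :: complex \<Rightarrow> 'a \<Rightarrow> 'a::complex_hilbert_space"
proof
  fix a b :: complex and x y :: 'a
  show "1 *\<^sub>C x = x"
    using scaleC_of_real[of 1 x] by simp
qed (rule scaleC_add_right scaleC_add_left scaleC_scaleC)+

definition compact_operator :: "('a::complex_hilbert_space \<Rightarrow> 'a) \<Rightarrow> bool" where
  "compact_operator T \<longleftrightarrow>
     Vector_Spaces.linear scaleC scaleC T \<and> compact (closure (T ` cball 0 1))"

definition cadjoint :: "('a::complex_hilbert_space \<Rightarrow> 'a) \<Rightarrow> 'a \<Rightarrow> 'a" where
  "cadjoint T = (THE S. \<forall>x y. cinner (T x) y = cinner x (S y))"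

definition eigenspace :: "('a::complex_hilbert_space \<Rightarrow> 'a) \<Rightarrow> real \<Rightarrow> 'a set" where
  "eigenspace T l = {x. T x = l *\<^sub>R x}"

definition orth_proj :: "'a::complex_hilbert_space set \<Rightarrow> 'a \<Rightarrow> 'a" where
  "orth_proj M x = (THE y. y \<in> M \<and> (\<forall>z\<in>M. cinner (x - y) z = 0))"

text \<open>
  Functional calculus of a compact self-adjoint operator \<open>T\<close> through its spectral decomposition:
  \<open>f(T)\<close> is the strongly convergent sum of \<open>f(l) P\<^sub>l\<close> over the (real) eigenvalues \<open>l\<close> of \<open>T\<close>,
  including \<open>0\<close> if \<open>T\<close> is not injective, where \<open>P\<^sub>l\<close> projects onto the eigenspace of \<open>l\<close>.
\<close>

definition fun_calc :: "(real \<Rightarrow> real) \<Rightarrow> ('a::complex_hilbert_space \<Rightarrow> 'a) \<Rightarrow> 'a \<Rightarrow> 'a" where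
  "fun_calc f T x =
     (\<Sum>\<^sub>\<infinity>l\<in>{l. eigenspace T l \<noteq> {0}}. f l *\<^sub>R orth_proj (eigenspace T l) x)"

definition op_abs :: "('a::complex_hilbert_space \<Rightarrow> 'a) \<Rightarrow> 'a \<Rightarrow> 'a" where
  "op_abs T = fun_calc sqrt (cadjoint T \<circ> T)"

definition op_powr :: "('a::complex_hilbert_space \<Rightarrow> 'a) \<Rightarrow> real \<Rightarrow> 'a \<Rightarrow> 'a" where
  "op_powr T p = fun_calc (\<lambda>t. t powr p) T"

text \<open>
  For a positive compact operator \<open>T\<close>, \<open>eigval_seq T n\<close> is the \<open>(n + 1)\<close>-st largest nonzero
  eigenvalue of \<open>T\<close> counted with multiplicity, or \<open>0\<close> if there are at most \<open>n\<close> of them: the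
  unique decreasing nonnegative sequence in which each \<open>l > 0\<close> occurs as often as the complex
  dimension of its eigenspace. Finiteness has to be required since \<open>card\<close> is \<open>0\<close> on infinite sets.
\<close>

definition eigval_seq :: "('a::complex_hilbert_space \<Rightarrow> 'a) \<Rightarrow> nat \<Rightarrow> real" where
  "eigval_seq T = (THE s. decseq s \<and> (\<forall>n. 0 \<le> s n) \<and>
     (\<forall>l>0. finite {n. s n = l} \<and> card {n. s n = l} = cvec.dim (eigenspace T l)))"

text \<open>Indices are shifted by one against the usual \<open>\<Sum>i\<ge>1. (\<lambda>\<^sub>i - \<lambda>\<^sub>i\<^sub>+\<^sub>1) \<alpha>(i)\<close>,
  as \<open>eigval_seq\<close> starts at \<open>0\<close>.\<close>

definition choquet_trace :: "(nat \<Rightarrow> real) \<Rightarrow> ('a::complex_hilbert_space \<Rightarrow> 'a) \<Rightarrow> ennreal" where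
  "choquet_trace \<alpha> T =
     (\<Sum>n. ennreal ((eigval_seq T n - eigval_seq T (Suc n)) * \<alpha> (Suc n)))"

definition ennreal_powr :: "ennreal \<Rightarrow> real \<Rightarrow> ennreal" where
  "ennreal_powr x r = (if x = top then top else ennreal (enn2real x powr r))"

definition choquet_norm ::
    "(nat \<Rightarrow> real) \<Rightarrow> real \<Rightarrow> ('a::complex_hilbert_space \<Rightarrow> 'a) \<Rightarrow> ennreal" where
  "choquet_norm \<alpha> p a = ennreal_powr (choquet_trace \<alpha> (op_powr (op_abs a) p)) (1 / p)"

end

theory Submission
  imports Defs
begin

text \<open>
  For every compact \<open>T\<close>, maximising \<open>\<parallel>T x\<parallel>\<close> over unit vectors orthogonal to the previous maximisers
  yields singular vectors \<open>e\<^sub>n\<close> and singular values \<open>s\<^sub>n\<close> with \<open>T\<^sup>*T e\<^sub>n = s\<^sub>n\<^sup>2 e\<^sub>n\<close>, so that summation by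
  parts gives \<open>\<phi>\<^sub>\<alpha>(|T|\<^sup>p) = (\<Sum>n. c\<^sub>n\<^sub>+\<^sub>1 s\<^sub>n\<^sup>p)\<close>. By Ky Fan, the partial sums of the singular values of
  \<open>a + b\<close> are dominated by those of \<open>s\<^sub>n(a) + s\<^sub>n(b)\<close>. If \<open>c\<close> is decreasing, convexity of \<open>t\<^sup>p\<close> and
  summation by parts turn this into an inequality between the \<open>c\<close>-weighted sums of \<open>p\<close>-th powers,
  and Minkowski's inequality finishes the proof. Conversely, the triangle inequality for two diagonal
  operators that differ by swapping the diagonal entries \<open>1\<close> and \<open>1 - \<epsilon>\<close> in positions \<open>i\<close> and \<open>i + 1\<close>
  gives \<open>c\<^sub>i\<^sub>+\<^sub>1 \<le> c\<^sub>i\<close> to first order in \<open>\<epsilon>\<close>.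
\<close>

section \<open>Complex inner products\<close>

lemma cinner_add_right: "cinner x (y + z) = cinner x y + cinner x z"
  by (metis cinner_add_left cinner_commute complex_cnj_add)

lemma cinner_scaleC_right: "cinner x (a *\<^sub>C y) = cnj a * cinner x y"
  by (metis cinner_commute cinner_scaleC_left complex_cnj_mult)

lemma cinner_scaleR_left: "cinner (r *\<^sub>R x) y = complex_of_real r * cinner x y"
  by (metis cinner_scaleC_left scaleC_of_real)

lemma cinner_scaleR_right: "cinner x (r *\<^sub>R y) = complex_of_real r * cinner x y"
  by (metis cinner_scaleC_right scaleC_of_real complex_cnj_complex_of_real)

lemma cinner_zero_left [simp]: "cinner 0 y = 0"
  using cinner_scaleR_left[of 0 0 y] by simp

lemma cinner_zero_right [simp]: "cinner x 0 = 0"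
  using cinner_scaleR_right[of x 0 0] by simp

lemma cinner_diff_left: "cinner (x - y) z = cinner x z - cinner y z"
  using cinner_add_left[of "x - y" y z] by simp

lemma cinner_diff_right: "cinner x (y - z) = cinner x y - cinner x z"
  using cinner_add_right[of x "y - z" z] by simp

lemma cinner_sum_left: "cinner (\<Sum>i\<in>I. f i) y = (\<Sum>i\<in>I. cinner (f i) y)"
  by (induction I rule: infinite_finite_induct) (simp_all add: cinner_add_left)

lemma cinner_sum_right: "cinner x (\<Sum>i\<in>I. f i) = (\<Sum>i\<in>I. cinner x (f i))"
  by (induction I rule: infinite_finite_induct) (simp_all add: cinner_add_right)

lemma cinner_eq_0_commute: "cinner x y = 0 \<longleftrightarrow> cinner y x = 0"
  by (metis cinner_commute complex_cnj_zero_iff)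

lemma cinner_self_eq_0_iff [simp]: "cinner x x = 0 \<longleftrightarrow> x = 0"
  by (simp add: cinner_self)

lemma norm_sq_eq_cinner: "(norm x)\<^sup>2 = Re (cinner x x)"
  by (simp add: cinner_self)

lemma norm_eq_sqrt_cinner: "norm x = sqrt (Re (cinner x x))"
  by (simp add: cinner_self)

lemma Re_cinner_commute: "Re (cinner x y) = Re (cinner y x)"
  by (metis cinner_commute cnj.simps(1))

lemma norm_add_sq: "(norm (x + y))\<^sup>2 = (norm x)\<^sup>2 + 2 * Re (cinner x y) + (norm y)\<^sup>2"
  using Re_cinner_commute[of x y]
  by (simp add: norm_sq_eq_cinner cinner_add_left cinner_add_right)

lemma norm_diff_sq: "(norm (x - y))\<^sup>2 = (norm x)\<^sup>2 - 2 * Re (cinner x y) + (norm y)\<^sup>2"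
  using Re_cinner_commute[of x y]
  by (simp add: norm_sq_eq_cinner cinner_diff_left cinner_diff_right)

lemma norm_scaleC: "norm (a *\<^sub>C x) = cmod a * norm x"
proof -
  have "cinner (a *\<^sub>C x) (a *\<^sub>C x) = (a * cnj a) * cinner x x"
    by (simp add: cinner_scaleC_left cinner_scaleC_right)
  also have "\<dots> = complex_of_real ((cmod a * norm x)\<^sup>2)"
    by (simp only: complex_norm_square[symmetric] cinner_self power_mult_distrib of_real_mult)
  finally have "(norm (a *\<^sub>C x))\<^sup>2 = (cmod a * norm x)\<^sup>2"
    by (simp only: norm_sq_eq_cinner Re_complex_of_real)
  then show ?thesis by (simp add: power2_eq_iff_nonneg)
qed

section \<open>Pythagoras, Bessel and convergence of orthogonal families\<close>

lemma norm_sum_orthogonal_sq: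
  assumes "finite I" and "\<And>i j. i \<in> I \<Longrightarrow> j \<in> I \<Longrightarrow> i \<noteq> j \<Longrightarrow> cinner (v i) (v j) = 0"
  shows "(norm (\<Sum>i\<in>I. v i))\<^sup>2 = (\<Sum>i\<in>I. (norm (v i))\<^sup>2)"
  using assms
proof (induction I rule: finite_induct)
  case (insert a I)
  then have "cinner (v a) (sum v I) = 0"
    by (auto simp: cinner_sum_right intro!: sum.neutral)
  with insert show ?case by (simp add: norm_add_sq)
qed simp

text \<open>Allowing norms below \<open>1\<close>, in particular zero vectors, lets the left singular vectors
  \<open>T e\<^sub>n / s\<^sub>n\<close> be used without separating off the indices with \<open>s\<^sub>n = 0\<close>.\<close>

lemma bessel_inequality:
  assumes I: "finite I"
    and orth: "\<And>i j. i \<in> I \<Longrightarrow> j \<in> I \<Longrightarrow> i \<noteq> j \<Longrightarrow> cinner (e i) (e j) = 0"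
    and le1: "\<And>i. i \<in> I \<Longrightarrow> norm (e i) \<le> 1"
  shows "(\<Sum>i\<in>I. (cmod (cinner x (e i)))\<^sup>2) \<le> (norm x)\<^sup>2"
proof -
  let ?c = "\<lambda>i. cinner x (e i)"
  let ?y = "\<Sum>i\<in>I. ?c i *\<^sub>C e i"
  have "Re (cinner x ?y) = (\<Sum>i\<in>I. (cmod (?c i))\<^sup>2)"
    by (simp add: cinner_sum_right cinner_scaleC_right cmod_power2)
      (simp add: power2_eq_square)
  moreover have "(norm ?y)\<^sup>2 = (\<Sum>i\<in>I. (norm (?c i *\<^sub>C e i))\<^sup>2)"
    by (rule norm_sum_orthogonal_sq[OF I])
      (simp add: cinner_scaleC_left cinner_scaleC_right orth)
  moreover have "\<dots> \<le> (\<Sum>i\<in>I. (cmod (?c i))\<^sup>2)"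
    by (rule sum_mono)
      (simp add: norm_scaleC power_mult_distrib mult_left_le power_le_one le1)
  \<comment> \<open>With \<open>S\<close> for the sum of the squared coefficients,
    \<open>Re (cinner x ?y)\<close> is \<open>S\<close> and the squared norm of \<open>?y\<close> is
    at most \<open>S\<close>, so expanding the square leaves
    \<open>0 \<le> (norm x)\<^sup>2 - 2 * S + S\<close>.\<close>
  moreover have "0 \<le> (norm (x - ?y))\<^sup>2" by simp
  ultimately show ?thesis unfolding norm_diff_sq by linarith
qed

text \<open>Bessel for the single vector \<open>y /\<^sub>R norm y\<close>.\<close>

lemma cinner_cauchy_schwarz: "cmod (cinner x y) \<le> norm x * norm y"
proof (cases "y = 0")
  case False
  have "(\<Sum>i\<in>{()}. (cmod (cinner x (y /\<^sub>R norm y)))\<^sup>2) \<le> (norm x)\<^sup>2"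
    by (rule bessel_inequality[where e = "\<lambda>_. y /\<^sub>R norm y"]) (use False in auto)
  then have "cmod (cinner x (y /\<^sub>R norm y)) \<le> norm x"
    by (simp add: power2_le_iff_abs_le)
  with False show ?thesis
    by (simp add: cinner_scaleR_right norm_mult norm_inverse norm_divide divide_simps)
qed simp

lemma bounded_linear_cinner_left: "bounded_linear (\<lambda>x. cinner x y)"
  by (rule bounded_linear_intro[where K = "norm y"])
    (simp_all add: cinner_add_left cinner_scaleR_left scaleR_conv_of_real cinner_cauchy_schwarz)

lemma bounded_linear_cinner_right: "bounded_linear (cinner x)"
  by (rule bounded_linear_intro[where K = "norm x"])
    (simp_all add: cinner_add_right cinner_scaleR_right scaleR_conv_of_real
      cinner_cauchy_schwarz mult.commute[of _ "norm x"])

lemma bounded_linear_scaleC_left: "bounded_linear (\<lambda>a. a *\<^sub>C x)"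
proof (rule bounded_linear_intro[where K = "norm x"])
  fix r and a :: complex
  show "(r *\<^sub>R a) *\<^sub>C x = r *\<^sub>R (a *\<^sub>C x)"
    by (metis scaleC_of_real scaleC_scaleC scaleR_conv_of_real)
qed (simp_all add: scaleC_add_left norm_scaleC)

text \<open>By Pythagoras the squared norm of a block of terms is the matching block of the series
  of squared norms, which converges because it is bounded; completeness then gives the limit. The
  index set is arbitrary, as it may be a set of eigenvalues.\<close>

lemma summable_on_orthogonal:
  fixes v :: "'i \<Rightarrow> 'a::complex_hilbert_space"
  assumes orth: "\<And>i j. i \<in> L \<Longrightarrow> j \<in> L \<Longrightarrow> i \<noteq> j \<Longrightarrow> cinner (v i) (v j) = 0"
    and bound: "\<And>F. finite F \<Longrightarrow> F \<subseteq> L \<Longrightarrow> (\<Sum>i\<in>F. (norm (v i))\<^sup>2) \<le> C"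
  shows "v summable_on L"
proof -
  have "(\<lambda>i. (norm (v i))\<^sup>2) summable_on L"
    by (rule nonneg_bdd_above_summable_on) (auto intro!: bdd_aboveI[where M = C] bound)
  then obtain S where S: "((\<lambda>i. (norm (v i))\<^sup>2) has_sum S) L"
    by (auto simp: summable_on_def)
  have "\<exists>P. eventually P (finite_subsets_at_top L) \<and>
      (\<forall>F G. P F \<and> P G \<longrightarrow> dist (sum v F) (sum v G) < \<epsilon>)" if "\<epsilon> > 0" for \<epsilon>
  proof -
    \<comment> \<open>\<open>\<delta>\<close> is the square of \<open>\<epsilon> / 2\<close>: a
      block whose squared norms add up to less than \<open>\<delta>\<close> has norm below
      \<open>\<epsilon> / 2\<close>, and two large finite sets are compared through
      \<open>F0\<close>.\<close>
    define \<delta> where "\<delta> = \<epsilon>\<^sup>2 / 4"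
    have \<delta>: "\<delta> > 0" using that by (simp add: \<delta>_def)
    have ev: "\<forall>\<^sub>F F in finite_subsets_at_top L. dist (\<Sum>i\<in>F. (norm (v i))\<^sup>2) S < \<delta>"
      using S \<delta> unfolding has_sum_def tendsto_iff by blast
    then obtain F0 where F0: "finite F0" "F0 \<subseteq> L"
      and near: "\<And>F. finite F \<Longrightarrow> F0 \<subseteq> F \<Longrightarrow> F \<subseteq> L \<Longrightarrow> dist (\<Sum>i\<in>F. (norm (v i))\<^sup>2) S < \<delta>"
      unfolding eventually_finite_subsets_at_top by auto
    have tail: "norm (sum v F - sum v F0) < \<epsilon> / 2"
      if F: "finite F" "F0 \<subseteq> F" "F \<subseteq> L" for F
    proof -
      have "sum v F - sum v F0 = sum v (F - F0)"
        using F F0 by (simp add: sum_diff)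
      moreover have "(norm (sum v (F - F0)))\<^sup>2 = (\<Sum>i\<in>F - F0. (norm (v i))\<^sup>2)"
        using F by (intro norm_sum_orthogonal_sq orth) auto
      moreover have "\<dots> = (\<Sum>i\<in>F. (norm (v i))\<^sup>2) - (\<Sum>i\<in>F0. (norm (v i))\<^sup>2)"
        using F F0 by (simp add: sum_diff)
      moreover have "(\<Sum>i\<in>F. (norm (v i))\<^sup>2) \<le> S"
        by (rule finite_sum_le_has_sum[OF S]) (use F in auto)
      moreover have "S - (\<Sum>i\<in>F0. (norm (v i))\<^sup>2) < \<delta>"
        using near[OF F0(1) order_refl F0(2)] by (simp add: dist_real_def)
      ultimately have "(norm (sum v F - sum v F0))\<^sup>2 < (\<epsilon> / 2)\<^sup>2"
        unfolding \<delta>_def by (simp add: power_divide)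
      then show ?thesis
        by (rule power_less_imp_less_base) (use \<open>\<epsilon> > 0\<close> in simp)
    qed
    show ?thesis
    proof (intro exI conjI allI impI)
      show "\<forall>\<^sub>F F in finite_subsets_at_top L. finite F \<and> F0 \<subseteq> F \<and> F \<subseteq> L"
        unfolding eventually_finite_subsets_at_top using F0 by auto
      fix F G
      assume FG: "(finite F \<and> F0 \<subseteq> F \<and> F \<subseteq> L) \<and> (finite G \<and> F0 \<subseteq> G \<and> G \<subseteq> L)"
      then have "norm (sum v F - sum v F0) < \<epsilon> / 2" "norm (sum v G - sum v F0) < \<epsilon> / 2"
        using tail by blast+
      then show "dist (sum v F) (sum v G) < \<epsilon>"
        by (metis dist_norm dist_triangle_half_l)
    qed
  qed
  then have "cauchy_filter (filtermap (sum v) (finite_subsets_at_top L))"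
    by (simp add: cauchy_filter_metric_filtermap)
  moreover have "complete (UNIV :: 'a set)"
    by (meson Cauchy_convergent UNIV_I complete_def convergent_def)
  ultimately obtain l where "(sum v \<longlongrightarrow> l) (finite_subsets_at_top L)"
    using complete_uniform[where S = UNIV] by (force simp add: filterlim_def)
  then show ?thesis
    unfolding summable_on_def has_sum_def by blast
qed

section \<open>Diagonal operators and their functional calculus\<close>

definition orthonormal :: "(nat \<Rightarrow> 'a::complex_hilbert_space) \<Rightarrow> bool" where
  "orthonormal e \<longleftrightarrow> (\<forall>i j. cinner (e i) (e j) = (if i = j then 1 else 0))"

lemma orthonormalD: "orthonormal e \<Longrightarrow> cinner (e i) (e j) = (if i = j then 1 else 0)"
  by (simp add: orthonormal_def)

lemma orthonormal_norm: "orthonormal e \<Longrightarrow> norm (e i) = 1"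
  using orthonormalD[of e i i] by (simp add: norm_eq_sqrt_cinner)

lemma orthonormal_compose: "orthonormal e \<Longrightarrow> inj \<pi> \<Longrightarrow> orthonormal (e \<circ> \<pi>)"
  by (simp add: orthonormal_def inj_eq)

lemma cinner_sum_orthonormal:
  assumes "orthonormal e" and "finite N"
  shows "cinner (\<Sum>n\<in>N. a n *\<^sub>C e n) (e m) = (if m \<in> N then a m else 0)"
proof -
  have "cinner (\<Sum>n\<in>N. a n *\<^sub>C e n) (e m) = (\<Sum>n\<in>N. if m = n then a n else 0)"
    by (auto simp: cinner_sum_left cinner_scaleC_left orthonormalD[OF assms(1)] intro!: sum.cong)
  with assms(2) show ?thesis by simp
qed

lemma independent_orthonormal:
  assumes "orthonormal e" shows "cvec.independent (e ` N)"
proof -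
  have inj: "inj e"
    by (rule injI) (metis assms orthonormalD zero_neq_one)
  have "f v = 0" if "finite S" "S \<subseteq> e ` N" "(\<Sum>v\<in>S. f v *\<^sub>C v) = 0" "v \<in> S" for S f v
  proof -
    from that(2) obtain M where M: "S = e ` M"
      by (metis subset_image_iff)
    with that inj have "finite M" by (meson finite_imageD inj_on_subset subset_UNIV)
    moreover have "(\<Sum>n\<in>M. f (e n) *\<^sub>C e n) = 0"
      using that(3) inj unfolding M by (simp add: sum.reindex inj_on_subset o_def)
    ultimately have "f (e m) = 0" if "m \<in> M" for m
      using cinner_sum_orthonormal[OF assms, of M "\<lambda>n. f (e n)" m] that by simp
    with that(4) show ?thesis unfolding M by auto
  qed
  then show ?thesis
    unfolding cvec.dependent_explicit by blast
qed

text \<open>\<open>diagonal e t B\<close> says in weak form that \<open>B x = (\<Sum>n. t\<^sub>n \<langle>x, e\<^sub>n\<rangle> e\<^sub>n)\<close>. Linearity and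
  boundedness of \<open>B\<close> need not be assumed, so the predicate passes through \<open>fun_calc\<close> easily.\<close>

definition diagonal ::
    "(nat \<Rightarrow> 'a::complex_hilbert_space) \<Rightarrow> (nat \<Rightarrow> real) \<Rightarrow> ('a \<Rightarrow> 'a) \<Rightarrow> bool" where
  "diagonal e t B \<longleftrightarrow> orthonormal e \<and> decseq t \<and> (\<forall>n. 0 \<le> t n) \<and> t \<longlonglongrightarrow> 0 \<and>
     (\<forall>x n. cinner (B x) (e n) = t n * cinner x (e n)) \<and>
     (\<forall>x y. (\<forall>n. cinner y (e n) = 0) \<longrightarrow> cinner (B x) y = 0)"

section \<open>Eigenspaces of a diagonal operator and their dimensions\<close>

lemma finite_level_set:
  assumes "t \<longlonglongrightarrow> (0::real)" and "l \<noteq> 0"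
  shows "finite {n. t n = l}"
proof -
  have "\<forall>\<^sub>F n in sequentially. t n \<noteq> l"
    using tendsto_imp_eventually_ne[OF assms(1)] assms(2) by auto
  then show ?thesis
    by (simp add: eventually_cofinite flip: cofinite_eq_sequentially)
qed

lemma diagonal_eigenspace_orthogonal:
  assumes "diagonal e t B" and "x \<in> eigenspace B l" and "t n \<noteq> l"
  shows "cinner x (e n) = 0"
proof -
  have "t n * cinner x (e n) = l * cinner x (e n)"
    using assms(1,2) by (metis (mono_tags) cinner_scaleR_left diagonal_def eigenspace_def mem_Collect_eq)
  with assms(3) show ?thesis by simp
qed

lemma diagonal_eigenspace_perp:
  assumes "diagonal e t B" and "x \<in> eigenspace B l" and "l \<noteq> 0"
    and "\<And>n. cinner y (e n) = 0"
  shows "cinner x y = 0"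
proof -
  have "cinner (B x) y = 0"
    using assms(1,4) by (auto simp: diagonal_def)
  with assms(2,3) show ?thesis
    by (simp add: eigenspace_def cinner_scaleR_left)
qed

text \<open>Since \<open>B\<close> is not assumed linear, it cannot be applied term by term. Instead
  the residual \<open>B ?x - l *\<^sub>R ?x\<close> is orthogonal to every \<open>e n\<close>, hence
  to \<open>B ?x\<close> by the last clause of \<open>diagonal\<close> and to \<open>?x\<close> as a
  combination of the \<open>e n\<close>; so it is orthogonal to itself.\<close>

lemma diagonal_eigenvector_combination:
  assumes B: "diagonal e t B" and N: "finite N" "N \<subseteq> {n. t n = l}"
  shows "(\<Sum>n\<in>N. a n *\<^sub>C e n) \<in> eigenspace B l"
proof -
  let ?x = "\<Sum>n\<in>N. a n *\<^sub>C e n"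
  let ?y = "B ?x - l *\<^sub>R ?x"
  have e: "orthonormal e" using B by (simp add: diagonal_def)
  have perp: "cinner ?y (e n) = 0" for n
    using B N by (auto simp: diagonal_def cinner_diff_left cinner_scaleR_left
        cinner_sum_orthonormal[OF e N(1)])
  then have "cinner (B ?x) ?y = 0" using B by (auto simp: diagonal_def)
  moreover have "cinner ?x ?y = 0"
    unfolding cinner_eq_0_commute[of ?x ?y]
    using perp by (simp only: cinner_sum_right cinner_scaleC_right) simp
  ultimately have "cinner ?y ?y = 0"
    by (simp only: cinner_diff_left[of "B ?x"] cinner_scaleR_left) simp
  then show ?thesis by (simp add: eigenspace_def)
qed

lemma diagonal_eigenvector: "diagonal e t B \<Longrightarrow> e n \<in> eigenspace B (t n)"
  using diagonal_eigenvector_combination[of e t B "{n}" "t n" "\<lambda>_. 1"] by simp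

text \<open>Both \<open>x\<close> and its projection \<open>P\<close> are eigenvectors for
  \<open>l\<close>, and for nonzero \<open>l\<close> eigenvectors are orthogonal to anything
  orthogonal to all \<open>e n\<close>, in particular to \<open>x - P\<close>. The kernel behaves
  differently: it contains everything orthogonal to all \<open>e n\<close>.\<close>

lemma diagonal_eigenspace_expansion:
  assumes B: "diagonal e t B" and l: "l \<noteq> 0" and x: "x \<in> eigenspace B l"
  shows "x = (\<Sum>n | t n = l. cinner x (e n) *\<^sub>C e n)"
proof -
  have e: "orthonormal e" and fin: "finite {n. t n = l}"
    using B l finite_level_set by (auto simp: diagonal_def)
  define P where "P = (\<Sum>n | t n = l. cinner x (e n) *\<^sub>C e n)"
  have perp: "cinner (x - P) (e n) = 0" for n
    using diagonal_eigenspace_orthogonal[OF B x]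
    by (auto simp: P_def cinner_diff_left cinner_sum_orthonormal[OF e fin])
  have "cinner x (x - P) = 0" "cinner P (x - P) = 0"
    using diagonal_eigenspace_perp[OF B _ l perp] x
      diagonal_eigenvector_combination[OF B fin order_refl] by (auto simp: P_def)
  then have "cinner (x - P) (x - P) = 0"
    by (simp only: cinner_diff_left[of x]) simp
  then show ?thesis by (simp add: P_def)
qed

lemma diagonal_dim_eigenspace:
  assumes B: "diagonal e t B" and l: "l \<noteq> 0"
  shows "cvec.dim (eigenspace B l) = card {n. t n = l}"
proof -
  have e: "orthonormal e" and fin: "finite {n. t n = l}"
    using B l finite_level_set by (auto simp: diagonal_def)
  have inj: "inj e"
    by (rule injI) (metis e orthonormalD zero_neq_one)
  have "cvec.span (e ` {n. t n = l}) = eigenspace B l"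
  proof (intro equalityI subsetI)
    fix x assume "x \<in> cvec.span (e ` {n. t n = l})"
    then obtain f where "x = (\<Sum>v\<in>e ` {n. t n = l}. f v *\<^sub>C v)"
      using fin by (auto simp: cvec.span_finite)
    then have "x = (\<Sum>n | t n = l. f (e n) *\<^sub>C e n)"
      using inj by (simp add: sum.reindex inj_on_subset o_def)
    then show "x \<in> eigenspace B l"
      using diagonal_eigenvector_combination[OF B fin order_refl, of "\<lambda>n. f (e n)"] by simp
  next
    fix x assume "x \<in> eigenspace B l"
    note x = diagonal_eigenspace_expansion[OF B l this]
    have "(\<Sum>n | t n = l. cinner x (e n) *\<^sub>C e n) \<in> cvec.span (e ` {n. t n = l})"
      by (intro cvec.span_sum cvec.span_scale cvec.span_base imageI)
    then show "x \<in> cvec.span (e ` {n. t n = l})"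
      by (simp only: x[symmetric])
  qed
  then have "cvec.dim (eigenspace B l) = card (e ` {n. t n = l})"
    using cvec.dim_eq_card_independent[OF independent_orthonormal[OF e]] cvec.dim_span by metis
  also have "\<dots> = card {n. t n = l}"
    by (rule card_image) (use inj in \<open>auto intro: inj_on_subset\<close>)
  finally show ?thesis .
qed

section \<open>Uniqueness of the eigenvalue sequence\<close>

text \<open>If \<open>t n > s n\<close>, the decreasing \<open>s\<close> takes the positive value
  \<open>t n\<close> only before \<open>n\<close>, where it agrees with \<open>t\<close>. As
  \<open>t\<close> takes that value at \<open>n\<close> too, its level set is strictly larger,
  against equality of cardinalities.\<close>

lemma decseq_le_if_card_levels_eq:
  fixes s t :: "nat \<Rightarrow> real"
  assumes s: "decseq s" "\<And>n. 0 \<le> s n"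
    and fin: "\<And>l. l > 0 \<Longrightarrow> finite {n. s n = l}"
    and card: "\<And>l. l > 0 \<Longrightarrow> finite {n. t n = l} \<and> card {n. t n = l} = card {n. s n = l}"
    and eq: "\<And>m. m < n \<Longrightarrow> s m = t m"
  shows "t n \<le> s n"
proof (rule ccontr)
  assume less: "\<not> t n \<le> s n"
  then have pos: "t n > 0" using s(2)[of n] by linarith
  have below: "s m \<noteq> t n" if "n \<le> m" for m
    using decseqD[OF s(1) that] less by linarith
  have "{m. s m = t n} \<subseteq> {m. t m = t n}"
  proof
    fix m assume "m \<in> {m. s m = t n}"
    then show "m \<in> {m. t m = t n}"
      using below[of m] eq[of m] by (cases "n \<le> m") auto
  qed
  moreover have "n \<notin> {m. s m = t n}" using below by blast
  ultimately have "{m. s m = t n} \<subset> {m. t m = t n}" by blast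
  from psubset_card_mono[OF _ this] card[OF pos] show False by simp
qed

text \<open>Uniqueness for the definite description in \<open>eigval_seq\<close>: strong induction
  on the index, with the preceding comparison used in both directions.\<close>

lemma decseq_eqI_card_levels:
  fixes s t :: "nat \<Rightarrow> real"
  assumes s: "decseq s" "\<And>n. 0 \<le> s n" and t: "decseq t" "\<And>n. 0 \<le> t n"
    and fin: "\<And>l. l > 0 \<Longrightarrow> finite {n. s n = l}" "\<And>l. l > 0 \<Longrightarrow> finite {n. t n = l}"
    and card: "\<And>l. l > 0 \<Longrightarrow> card {n. s n = l} = card {n. t n = l}"
  shows "s = t"
proof
  fix n show "s n = t n"
  proof (induction n rule: less_induct)
    case (less n)
    then show ?case
      using decseq_le_if_card_levels_eq[of s t n] decseq_le_if_card_levels_eq[of t s n]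
        assms by (simp add: order_antisym)
  qed
qed

lemma eigval_seq_diagonal:
  assumes B: "diagonal e t B" shows "eigval_seq B = t"
  unfolding eigval_seq_def
proof (rule the_equality)
  have t: "decseq t" "\<And>n. 0 \<le> t n" "\<And>l. l > 0 \<Longrightarrow> finite {n. t n = l}"
    using B by (auto simp: diagonal_def finite_level_set)
  show "decseq t \<and> (\<forall>n. 0 \<le> t n) \<and>
      (\<forall>l>0. finite {n. t n = l} \<and> card {n. t n = l} = cvec.dim (eigenspace B l))"
    using t diagonal_dim_eigenspace[OF B] by auto
  fix s assume s: "decseq s \<and> (\<forall>n. 0 \<le> s n) \<and>
      (\<forall>l>0. finite {n. s n = l} \<and> card {n. s n = l} = cvec.dim (eigenspace B l))"
  then have "card {n. s n = l} = card {n. t n = l}" if "l > 0" for l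
    using diagonal_dim_eigenspace[OF B, of l] that by simp
  with s t show "s = t"
    by (intro decseq_eqI_card_levels) blast+
qed

section \<open>Spectral projections and functional calculus\<close>

lemma orth_proj_diagonal:
  assumes B: "diagonal e t B" and l: "l \<noteq> 0"
  shows "orth_proj (eigenspace B l) x = (\<Sum>n | t n = l. cinner x (e n) *\<^sub>C e n)"
proof -
  have e: "orthonormal e" and fin: "finite {n. t n = l}"
    using B l finite_level_set by (auto simp: diagonal_def)
  let ?P = "\<Sum>n | t n = l. cinner x (e n) *\<^sub>C e n"
  have "cinner (x - ?P) (e n) = 0" if "t n = l" for n
    using that by (simp add: cinner_diff_left cinner_sum_orthonormal[OF e fin])
  then have sum0: "cinner (x - ?P) (\<Sum>n | t n = l. a n *\<^sub>C e n) = 0" for a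
    unfolding cinner_sum_right cinner_scaleC_right by (intro sum.neutral) simp
  have orth: "cinner (x - ?P) z = 0" if "z \<in> eigenspace B l" for z
    using sum0[of "\<lambda>n. cinner z (e n)"]
    by (simp only: diagonal_eigenspace_expansion[OF B l that, symmetric])
  show ?thesis
    unfolding orth_proj_def
  proof (rule the_equality)
    show "?P \<in> eigenspace B l \<and> (\<forall>z\<in>eigenspace B l. cinner (x - ?P) z = 0)"
      using diagonal_eigenvector_combination[OF B fin order_refl, of "\<lambda>n. cinner x (e n)"] orth
      by simp
    fix y assume y: "y \<in> eigenspace B l \<and> (\<forall>z\<in>eigenspace B l. cinner (x - y) z = 0)"
    have "cinner y (e n) = cinner x (e n)" if "t n = l" for n
      using y diagonal_eigenvector[OF B, of n] that by (auto simp: cinner_diff_left)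
    then have "(\<Sum>n | t n = l. cinner y (e n) *\<^sub>C e n) = ?P"
      by (intro sum.cong) auto
    moreover have "y = (\<Sum>n | t n = l. cinner y (e n) *\<^sub>C e n)"
      using diagonal_eigenspace_expansion[OF B l] y by blast
    ultimately show "y = ?P" by (rule trans[rotated])
  qed
qed

text \<open>The spectral terms are mutually orthogonal and square-bounded by Bessel, so their series
  converges and can be paired term by term with \<open>e n\<close>, or with vectors orthogonal to
  all \<open>e n\<close>. Monotonicity keeps the new entries decreasing; \<open>f 0 = 0\<close>
  makes them nonnegative and removes the kernel projection from the sum.\<close>

lemma diagonal_fun_calc:
  fixes f :: "real \<Rightarrow> real"
  assumes B: "diagonal e t B" and f0: "f 0 = 0" and mono: "mono_on {0..} f"
    and lim: "(\<lambda>n. f (t n)) \<longlonglongrightarrow> 0"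
  shows "diagonal e (\<lambda>n. f (t n)) (fun_calc f B)"
proof -
  have e: "orthonormal e" and t: "decseq t" "\<And>n. 0 \<le> t n" "t \<longlonglongrightarrow> 0"
    using B by (auto simp: diagonal_def)
  have ft: "decseq (\<lambda>n. f (t n))"
    unfolding decseq_def using mono_onD[OF mono] t(2) decseqD[OF t(1)] by simp
  have ft0: "0 \<le> f (t n)" for n
    using mono_onD[OF mono, of 0 "t n"] t(2)[of n] f0 by simp
  define L where "L = {l. eigenspace B l \<noteq> {0}}"
  define v where "v x l = f l *\<^sub>R orth_proj (eigenspace B l) x" for x l
  have v0: "v x 0 = 0" for x by (simp add: v_def f0)
  have v: "v x l = (\<Sum>n | t n = l. (f l * cinner x (e n)) *\<^sub>C e n)" if "l \<noteq> 0" for x l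
    using that by (simp add: v_def orth_proj_diagonal[OF B] cvec.scale_sum_right
        flip: scaleC_of_real)
  have ve: "cinner (v x l) (e n) = (if l = t n then f l * cinner x (e n) else 0)" for x l n
  proof (cases "l = 0")
    case False
    then show ?thesis
      by (simp add: v cinner_sum_orthonormal[OF e] finite_level_set[OF t(3)])
  qed (simp add: v0 f0)
  have orth: "cinner (v x l) (v x l') = 0" if "l \<noteq> l'" for x l l'
  proof (cases "l' = 0")
    case False
    then show ?thesis
      using that by (simp add: v[of l'] cinner_sum_right cinner_scaleC_right ve)
  qed (simp add: v0)
  have norm_v: "(norm (v x l))\<^sup>2 \<le> (f (t 0))\<^sup>2 * (\<Sum>n | t n = l. (cmod (cinner x (e n)))\<^sup>2)"
    if "l \<noteq> 0" for x l
  proof -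
    have "(norm (v x l))\<^sup>2 = (\<Sum>n | t n = l. (norm ((f l * cinner x (e n)) *\<^sub>C e n))\<^sup>2)"
      unfolding v[OF that]
      by (rule norm_sum_orthogonal_sq)
        (auto simp: finite_level_set[OF t(3) that] cinner_scaleC_left cinner_scaleC_right
          orthonormalD[OF e])
    also have "\<dots> = (\<Sum>n | t n = l. (f l)\<^sup>2 * (cmod (cinner x (e n)))\<^sup>2)"
      by (simp add: norm_scaleC orthonormal_norm[OF e] norm_mult power_mult_distrib)
    also have "\<dots> \<le> (\<Sum>n | t n = l. (f (t 0))\<^sup>2 * (cmod (cinner x (e n)))\<^sup>2)"
      using ft0 decseqD[OF ft, of 0]
      by (intro sum_mono mult_right_mono power_mono) auto
    finally show ?thesis by (simp add: sum_distrib_left)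
  qed
  have bound: "(\<Sum>l\<in>F. (norm (v x l))\<^sup>2) \<le> (f (t 0))\<^sup>2 * (norm x)\<^sup>2"
    if F: "finite F" for x F
  proof -
    have fin: "finite {n. t n = l}" if "l \<in> F - {0}" for l
      using that finite_level_set[OF t(3)] by auto
    have "(\<Sum>l\<in>F. (norm (v x l))\<^sup>2) = (\<Sum>l\<in>F - {0}. (norm (v x l))\<^sup>2)"
      using F by (intro sum.mono_neutral_right) (auto simp: v0)
    also have "\<dots> \<le> (\<Sum>l\<in>F - {0}. (f (t 0))\<^sup>2 * (\<Sum>n | t n = l. (cmod (cinner x (e n)))\<^sup>2))"
      by (intro sum_mono norm_v) auto
    also have "\<dots> = (f (t 0))\<^sup>2 * (\<Sum>l\<in>F - {0}. \<Sum>n | t n = l. (cmod (cinner x (e n)))\<^sup>2)"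
      by (simp add: sum_distrib_left)
    \<comment> \<open>Level sets of different eigenvalues are disjoint, so the double sum runs over
      distinct \<open>n\<close> and Bessel bounds it independently of \<open>F\<close>.\<close>
    also have "(\<Sum>l\<in>F - {0}. \<Sum>n | t n = l. (cmod (cinner x (e n)))\<^sup>2) =
        (\<Sum>n\<in>(\<Union>l\<in>F - {0}. {n. t n = l}). (cmod (cinner x (e n)))\<^sup>2)"
      using F fin by (subst sum.UNION_disjoint) auto
    also have "\<dots> \<le> (norm x)\<^sup>2"
      using F fin by (intro bessel_inequality) (auto simp: orthonormalD[OF e] orthonormal_norm[OF e])
    finally show ?thesis by (simp add: mult_left_mono)
  qed
  have sum: "(v x has_sum fun_calc f B x) L" for x
    unfolding fun_calc_def L_def[symmetric] v_def[symmetric, abs_def]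
    by (rule has_sum_infsum, rule summable_on_orthogonal[where C = "(f (t 0))\<^sup>2 * (norm x)\<^sup>2"])
      (use orth bound in auto)
  have "cinner (fun_calc f B x) (e n) = f (t n) * cinner x (e n)" for x n
  proof -
    have "((\<lambda>l. cinner (v x l) (e n)) has_sum cinner (fun_calc f B x) (e n)) L"
      using has_sum_bounded_linear[OF bounded_linear_cinner_left sum[of x]] by (simp add: o_def)
    \<comment> \<open>As a nonzero eigenvector, \<open>e n\<close> puts \<open>t n\<close> into
      \<open>L\<close>, so the one term that may survive the pairing is really part of the
      sum.\<close>
    moreover have "e n \<noteq> 0"
      using orthonormal_norm[OF e, of n] by force
    then have "t n \<in> L"
      using diagonal_eigenvector[OF B, of n] unfolding L_def by blast
    then have "((\<lambda>l. cinner (v x l) (e n)) has_sum f (t n) * cinner x (e n)) L"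
      by (intro has_sum_finite_neutralI[where B = "{t n}"]) (simp_all add: ve)
    ultimately show ?thesis by (rule has_sum_unique)
  qed
  moreover have "cinner (fun_calc f B x) y = 0" if "\<And>n. cinner y (e n) = 0" for x y
  proof -
    have "cinner (e n) y = 0" for n
      using that cinner_eq_0_commute by blast
    then have "cinner (v x l) y = 0" for l
      by (cases "l = 0") (simp_all add: v0 v cinner_sum_left cinner_scaleC_left)
    moreover have "((\<lambda>l. cinner (v x l) y) has_sum cinner (fun_calc f B x) y) L"
      using has_sum_bounded_linear[OF bounded_linear_cinner_left sum[of x]] by (simp add: o_def)
    ultimately have "((\<lambda>_. 0) has_sum cinner (fun_calc f B x) y) L" by simp
    then show ?thesis using has_sum_unique[OF _ has_sum_0[of L "\<lambda>_. 0"]] by simp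
  qed
  ultimately show ?thesis
    using e ft ft0 lim by (simp add: diagonal_def)
qed

section \<open>Compact operators and singular systems\<close>

lemma clinear_iff:
  "Vector_Spaces.linear scaleC scaleC T \<longleftrightarrow>
     (\<forall>x y. T (x + y) = T x + T y) \<and> (\<forall>a x. T (a *\<^sub>C x) = a *\<^sub>C T x)"
  for T :: "'a::complex_hilbert_space \<Rightarrow> 'a"
proof -
  have "vector_space (scaleC :: complex \<Rightarrow> 'a \<Rightarrow> 'a)" by unfold_locales
  then show ?thesis
    by (auto simp: Vector_Spaces.linear_iff)
qed

lemma compact_operator_add: "compact_operator T \<Longrightarrow> T (x + y) = T x + T y"
  and compact_operator_scaleC: "compact_operator T \<Longrightarrow> T (a *\<^sub>C x) = a *\<^sub>C T x"
  by (simp_all add: compact_operator_def clinear_iff)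

lemma compact_operator_scaleR: "compact_operator T \<Longrightarrow> T (r *\<^sub>R x) = r *\<^sub>R T x"
  by (metis compact_operator_scaleC scaleC_of_real)

lemma bounded_linear_compact_operator:
  assumes "compact_operator T" shows "bounded_linear T"
proof -
  have "bounded (T ` cball 0 1)"
    using assms compact_imp_bounded bounded_subset closure_subset
    unfolding compact_operator_def by blast
  then obtain K where "\<forall>y\<in>T ` cball 0 1. norm y \<le> K"
    unfolding bounded_iff by blast
  then have K: "norm (T x) \<le> K" if "norm x \<le> 1" for x
    using that by simp
  show ?thesis
  proof (rule bounded_linear_intro[where K = K])
    fix x
    show "norm (T x) \<le> norm x * K"
    proof (cases "x = 0")
      case True
      then show ?thesis
        using compact_operator_scaleR[OF assms, of 0 0] by simp
    next
      case False
      then have "norm (T (x /\<^sub>R norm x)) \<le> K" by (intro K) simp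
      with False show ?thesis
        by (simp add: compact_operator_scaleR[OF assms] divide_simps)
          (simp add: mult.commute)
    qed
  qed (simp_all add: assms compact_operator_add compact_operator_scaleR)
qed

lemma compact_operator_convergent_subseq:
  assumes "compact_operator T" and "\<And>k::nat. norm (x k) \<le> 1"
  obtains w r where "strict_mono (r :: nat \<Rightarrow> nat)" and "(\<lambda>k. T (x (r k))) \<longlonglongrightarrow> w"
proof -
  have "seq_compact (closure (T ` cball 0 1))"
    using assms(1) by (simp add: compact_operator_def compact_imp_seq_compact)
  moreover have "T (x k) \<in> closure (T ` cball 0 1)" for k
    by (rule subsetD[OF closure_subset]) (simp add: assms(2))
  ultimately show ?thesis
    using seq_compactE[of "closure (T ` cball 0 1)" "\<lambda>k. T (x k)"] that
    unfolding comp_def by metis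
qed

lemma compact_operatorI_subset:
  assumes "\<And>x y. T (x + y) = T x + T y" and "\<And>a x. T (a *\<^sub>C x) = a *\<^sub>C T x"
    and sub: "T ` cball 0 1 \<subseteq> K" and K: "compact K"
  shows "compact_operator T"
proof -
  have "closure (T ` cball 0 1) \<subseteq> K"
    using sub K by (simp add: closure_minimal compact_imp_closed)
  then have "compact (closure (T ` cball 0 1))"
    using compact_Int_closed[OF K, of "closure (T ` cball 0 1)"] by (simp add: Int_absorb1)
  with assms(1,2) show ?thesis
    by (simp add: compact_operator_def clinear_iff)
qed

text \<open>The image of the unit ball lies in the Minkowski sum of two compact sets, which is
  compact.\<close>

lemma compact_operator_plus:
  assumes "compact_operator a" and "compact_operator b"
  shows "compact_operator (\<lambda>x. a x + b x)"
proof (rule compact_operatorI_subset)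
  let ?K = "\<lambda>T. closure (T ` cball 0 1)"
  show "compact {x + y | x y. x \<in> ?K a \<and> y \<in> ?K b}"
    using assms by (intro compact_sums) (auto simp: compact_operator_def)
  show "(\<lambda>x. a x + b x) ` cball 0 1 \<subseteq> {x + y | x y. x \<in> ?K a \<and> y \<in> ?K b}"
    using closure_subset by blast
qed (simp_all add: assms compact_operator_add compact_operator_scaleC scaleC_add_right)

text \<open>A maximising sequence of unit vectors is Cauchy as soon as its images converge: by the
  parallelogram law \<open>\<parallel>x + y\<parallel>\<close> close to \<open>2\<close> forces \<open>\<parallel>x - y\<parallel>\<close> to be small. No weak compactness
  and no adjoint are needed.\<close>

lemma compact_operator_attains_norm:
  fixes T :: "'a::complex_hilbert_space \<Rightarrow> 'a"
  assumes T: "compact_operator T" and M: "cvec.subspace M" "closed M"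
    and x0: "x0 \<in> M" "x0 \<noteq> 0"
  obtains u where "u \<in> M" and "norm u = 1" and "\<And>y. y \<in> M \<Longrightarrow> norm (T y) \<le> norm (T u) * norm y"
proof -
  note bl = bounded_linear_compact_operator[OF T]
  have scaleR_M: "r *\<^sub>R x \<in> M" if "x \<in> M" for r x
    using cvec.subspace_scale[OF M(1) that] scaleC_of_real by metis
  \<comment> \<open>The supremum \<open>\<sigma>\<close> of \<open>A\<close> is the operator norm of
    \<open>T\<close> restricted to \<open>M\<close>; the task is to attain it.\<close>
  define A where "A = (\<lambda>x. norm (T x)) ` (M \<inter> sphere 0 1)"
  define \<sigma> where "\<sigma> = Sup A"
  obtain K where K: "\<And>x. norm (T x) \<le> norm x * K"
    using bounded_linear.bounded[OF bl] by blast
  have bdd: "bdd_above A"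
  proof (rule bdd_aboveI[where M = K])
    show "a \<le> K" if "a \<in> A" for a
      using that K by (auto simp: A_def) (metis mult_1)
  qed
  have u0: "x0 /\<^sub>R norm x0 \<in> M \<inter> sphere 0 1"
    using x0 by (simp add: scaleR_M)
  have ne: "A \<noteq> {}" using u0 unfolding A_def by blast
  have unit_le: "norm (T x) \<le> \<sigma>" if "x \<in> M" "norm x = 1" for x
    unfolding \<sigma>_def using that by (intro cSup_upper[OF _ bdd]) (auto simp: A_def)
  have le: "norm (T y) \<le> \<sigma> * norm y" if "y \<in> M" for y
  proof (cases "y = 0")
    case False
    then have "norm (T (y /\<^sub>R norm y)) \<le> \<sigma>"
      using that by (intro unit_le) (simp_all add: scaleR_M)
    with False show ?thesis
      by (simp add: compact_operator_scaleR[OF T] divide_simps)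
  qed (use bl in \<open>simp add: linear_simps(3)\<close>)
  have "\<sigma> \<ge> 0"
    using order_trans[OF norm_ge_zero unit_le[of "x0 /\<^sub>R norm x0"]] u0 by simp
  then consider "\<sigma> = 0" | "\<sigma> > 0" by linarith
  then show ?thesis
  proof cases
    case 1
    then have "norm (T y) \<le> norm (T (x0 /\<^sub>R norm x0)) * norm y" if "y \<in> M" for y
      using le[OF that] by (simp add: order_trans[OF _ mult_nonneg_nonneg])
    with u0 show ?thesis by (intro that[of "x0 /\<^sub>R norm x0"]) auto
  next
    case 2
    have "\<exists>x. x \<in> M \<and> norm x = 1 \<and> \<sigma> - 1 / Suc k < norm (T x)" for k
    proof -
      have "\<sigma> - 1 / Suc k < Sup A" by (simp add: \<sigma>_def)
      then show ?thesis
        using ne bdd by (auto simp: less_cSup_iff A_def)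
    qed
    then obtain x where x: "\<And>k. x k \<in> M" "\<And>k. norm (x k) = 1"
      "\<And>k. \<sigma> - 1 / Suc k < norm (T (x k))" by metis
    have "(\<lambda>k. norm (T (x k))) \<longlonglongrightarrow> \<sigma>"
    proof (rule tendsto_sandwich[where h = "\<lambda>_. \<sigma>" and f = "\<lambda>k. \<sigma> - 1 / Suc k"])
      show "(\<lambda>k. \<sigma> - 1 / Suc k) \<longlonglongrightarrow> \<sigma>"
        using tendsto_diff[OF tendsto_const LIMSEQ_Suc[OF lim_1_over_n], of \<sigma>] by simp
    qed (use x unit_le in \<open>auto intro!: always_eventually simp: less_imp_le\<close>)
    moreover obtain w r where r: "strict_mono r" and w: "(\<lambda>k. T (x (r k))) \<longlonglongrightarrow> w"
      by (rule compact_operator_convergent_subseq[OF T, of x]) (simp_all add: x(2))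
    ultimately have "(\<lambda>k. norm (T (x (r k)))) \<longlonglongrightarrow> \<sigma>"
      using LIMSEQ_subseq_LIMSEQ[OF _ r] by (simp add: o_def)
    from LIMSEQ_unique[OF tendsto_norm[OF w] this] have norm_w: "norm w = \<sigma>" .
    have "Cauchy (\<lambda>k. x (r k))"
    proof (rule metric_CauchyI)
      fix \<epsilon> :: real assume "\<epsilon> > 0"
      \<comment> \<open>The parallelogram law will bound the squared distance by
        \<open>4 - (2 - 2 * \<eta>)\<^sup>2\<close>, which is below \<open>9 * \<eta>\<close>. The
        cap \<open>1\<close> keeps \<open>2 - 2 * \<eta>\<close> nonnegative, so that squaring
        preserves the inequality.\<close>
      define \<eta> where "\<eta> = min 1 (\<epsilon>\<^sup>2 / 9)"
      have \<eta>: "0 < \<eta>" "\<eta> \<le> 1" "9 * \<eta> \<le> \<epsilon>\<^sup>2" using \<open>\<epsilon> > 0\<close> by (auto simp: \<eta>_def)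
      obtain N where N: "\<And>k. k \<ge> N \<Longrightarrow> norm (T (x (r k)) - w) < \<sigma> * \<eta>"
        using LIMSEQ_D[OF w, of "\<sigma> * \<eta>"] 2 \<eta> by auto
      have "dist (x (r j)) (x (r k)) < \<epsilon>" if "j \<ge> N" "k \<ge> N" for j k
      proof -
        let ?x = "x (r j)" and ?y = "x (r k)"
        \<comment> \<open>Both images are within \<open>\<sigma> * \<eta>\<close> of
          \<open>w\<close>, whose norm is \<open>\<sigma>\<close>. Hence \<open>T (?x + ?y)\<close>
          has norm nearly \<open>2 * \<sigma>\<close>, which forces \<open>?x + ?y\<close> to have
          norm nearly \<open>2\<close>.\<close>
        have "2 * norm w = norm ((T ?x + T ?y) - ((T ?x - w) + (T ?y - w)))"
          by (simp add: norm_scaleR[of 2 w, simplified] flip: scaleR_2)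
        also have "\<dots> \<le> norm (T (?x + ?y)) + (norm (T ?x - w) + norm (T ?y - w))"
          unfolding compact_operator_add[OF T]
          by (meson add_left_mono norm_triangle_ineq norm_triangle_ineq4 order_trans)
        also have "norm (T (?x + ?y)) \<le> \<sigma> * norm (?x + ?y)"
          by (rule le) (simp add: x cvec.subspace_add[OF M(1)])
        finally have "\<sigma> * (2 - 2 * \<eta>) \<le> \<sigma> * norm (?x + ?y)"
          using N[OF that(1)] N[OF that(2)] by (simp add: norm_w algebra_simps)
        then have "2 - 2 * \<eta> \<le> norm (?x + ?y)" using 2 by simp
        then have "(2 - 2 * \<eta>)\<^sup>2 \<le> (norm (?x + ?y))\<^sup>2"
          using \<eta> by (intro power_mono) auto
        moreover have "(norm (?x - ?y))\<^sup>2 = 4 - (norm (?x + ?y))\<^sup>2"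
          by (simp add: norm_diff_sq norm_add_sq x)
        ultimately have "(norm (?x - ?y))\<^sup>2 \<le> 8 * \<eta> - 4 * \<eta>\<^sup>2"
          by (simp add: power2_eq_square algebra_simps)
        also have "\<dots> < \<epsilon>\<^sup>2" using \<eta> by (smt (verit) zero_le_power2)
        finally show ?thesis
          unfolding dist_norm by (rule power_less_imp_less_base) (use \<open>\<epsilon> > 0\<close> in simp)
      qed
      then show "\<exists>N. \<forall>j\<ge>N. \<forall>k\<ge>N. dist (x (r j)) (x (r k)) < \<epsilon>" by blast
    qed
    then obtain u where u: "(\<lambda>k. x (r k)) \<longlonglongrightarrow> u"
      using Cauchy_convergent convergent_def by blast
    have "u \<in> M"
      using closed_sequentially[OF M(2) _ u] x(1) by blast
    moreover have "norm u = 1"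
      using LIMSEQ_unique[OF tendsto_norm[OF u]] x(2) by simp
    moreover have "T u = w"
      using LIMSEQ_unique[OF bounded_linear.tendsto[OF bl u] w] .
    then have "norm (T y) \<le> norm (T u) * norm y" if "y \<in> M" for y
      using le[OF that] norm_w by simp
    ultimately show ?thesis using that by blast
  qed
qed

text \<open>First-order condition at a maximum: the form \<open>Q\<close> is nonnegative on
  \<open>M\<close> and vanishes at \<open>u\<close>, so its first variation at \<open>u\<close>,
  governed by \<open>q\<close>, has to vanish in every direction \<open>y\<close> of
  \<open>M\<close>.\<close>

lemma norm_maximiser_cinner:
  assumes T: "compact_operator T" and M: "cvec.subspace M" and u: "u \<in> M" "norm u = 1"
    and max: "\<And>y. y \<in> M \<Longrightarrow> norm (T y) \<le> norm (T u) * norm y" and y: "y \<in> M"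
  shows "cinner (T u) (T y) = (norm (T u))\<^sup>2 * cinner u y"
proof (rule ccontr)
  assume neq: "\<not> ?thesis"
  define \<sigma> where "\<sigma> = norm (T u)"
  define q where "q = \<sigma>\<^sup>2 * cinner u y - cinner (T u) (T y)"
  define Q where "Q v = \<sigma>\<^sup>2 * (norm v)\<^sup>2 - (norm (T v))\<^sup>2" for v
  have Q_nonneg: "0 \<le> Q v" if "v \<in> M" for v
    using power_mono[OF max[OF that] norm_ge_zero, of 2]
    by (simp add: Q_def \<sigma>_def power_mult_distrib)
  \<comment> \<open>Moving from \<open>u\<close> along \<open>y\<close> by \<open>?z\<close> changes
    \<open>Q\<close> by \<open>(cmod q)\<^sup>2 * (r * (r * Q y - 2))\<close>, which is negative
    once \<open>r * Q y < 2\<close>. The summand \<open>1\<close> keeps the denominator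
    positive.\<close>
  define r where "r = 1 / (Q y + 1)"
  have r: "0 < r" "r * Q y < 2" using Q_nonneg[OF y] by (auto simp: r_def divide_simps)
  let ?z = "- complex_of_real r * q"
  have "Q (u + ?z *\<^sub>C y) = 2 * Re (cnj ?z * q) + (cmod ?z)\<^sup>2 * Q y"
  proof -
    have "T (u + ?z *\<^sub>C y) = T u + ?z *\<^sub>C T y"
      by (simp only: compact_operator_add[OF T] compact_operator_scaleC[OF T])
    then show ?thesis
      by (simp only: Q_def norm_add_sq cinner_scaleC_right norm_scaleC)
        (simp add: q_def u \<sigma>_def[symmetric] power_mult_distrib algebra_simps)
  qed
  also have "\<dots> = (cmod q)\<^sup>2 * (r * (r * Q y - 2))"
    using r by (simp add: norm_mult power_mult_distrib cmod_power2)
      (simp add: power2_eq_square algebra_simps)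
  finally have "Q (u + ?z *\<^sub>C y) = (cmod q)\<^sup>2 * (r * (r * Q y - 2))" .
  moreover have "0 \<le> Q (u + ?z *\<^sub>C y)"
    using u y M by (intro Q_nonneg cvec.subspace_add cvec.subspace_scale)
  moreover have "q \<noteq> 0" using neq by (simp add: q_def \<sigma>_def)
  ultimately have "0 \<le> (cmod q)\<^sup>2 * (r * (r * Q y - 2))" "q \<noteq> 0" by simp_all
  with r show False by (simp add: zero_le_mult_iff)
qed

text \<open>\<open>s\<^sub>n\<close> is the \<open>n\<close>-th singular value of \<open>T\<close> and \<open>e\<^sub>n\<close> a corresponding right singular vector.\<close>

definition singular_system ::
    "('a::complex_hilbert_space \<Rightarrow> 'a) \<Rightarrow> (nat \<Rightarrow> 'a) \<Rightarrow> (nat \<Rightarrow> real) \<Rightarrow> bool" where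
  "singular_system T e s \<longleftrightarrow> orthonormal e \<and> decseq s \<and> (\<forall>n. 0 \<le> s n) \<and> s \<longlonglongrightarrow> 0 \<and>
     (\<forall>n y. cinner (T (e n)) (T y) = (s n)\<^sup>2 * cinner (e n) y) \<and>
     (\<forall>n y. (\<forall>j<n. cinner y (e j) = 0) \<longrightarrow> norm (T y) \<le> s n * norm y)"

section \<open>Construction of singular systems\<close>

lemma subspace_orthogonal_complement:
  "cvec.subspace {x. \<forall>j\<in>J. cinner x (e j) = 0}"
  by (rule cvec.subspaceI) (auto simp: cinner_add_left cinner_scaleC_left)

lemma closed_orthogonal_complement:
  "closed {x. \<forall>j\<in>J. cinner x (e j) = 0}"
proof -
  have "closed {x. cinner x (e j) = 0}" for j
    by (intro closed_Collect_eq linear_continuous_on bounded_linear_cinner_left continuous_intros)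
  moreover have "{x. \<forall>j\<in>J. cinner x (e j) = 0} = (\<Inter>j\<in>J. {x. cinner x (e j) = 0})" by auto
  ultimately show ?thesis by (simp only:) (intro closed_INT ballI)
qed

text \<open>A Gram-Schmidt step: take a vector outside the span of the finite family and subtract
  its projection onto that span.\<close>

lemma exists_orthogonal_vector:
  fixes e :: "nat \<Rightarrow> 'a::complex_hilbert_space"
  assumes inf: "\<not> (\<exists>B::'a set. finite B \<and> cvec.span B = UNIV)"
    and e: "\<And>i j. i < n \<Longrightarrow> j < n \<Longrightarrow> cinner (e i) (e j) = (if i = j then 1 else 0)"
  obtains x where "x \<noteq> 0" and "\<forall>j\<in>{..<n}. cinner x (e j) = 0"
proof -
  obtain x where x: "x \<notin> cvec.span (e ` {..<n})"
    using inf by (metis UNIV_eq_I finite_imageI finite_lessThan)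
  let ?P = "\<Sum>i<n. cinner x (e i) *\<^sub>C e i"
  have "?P \<in> cvec.span (e ` {..<n})"
    by (intro cvec.span_sum cvec.span_scale cvec.span_base imageI)
  with x have "x - ?P \<noteq> 0" by auto
  moreover have "cinner ?P (e j) = cinner x (e j)" if "j < n" for j
  proof -
    have "cinner ?P (e j) = (\<Sum>i<n. if i = j then cinner x (e i) else 0)"
      unfolding cinner_sum_left cinner_scaleC_left using e that by (intro sum.cong) auto
    with that show ?thesis by simp
  qed
  ultimately show ?thesis
    by (intro that[of "x - ?P"]) (auto simp: cinner_diff_left)
qed

theorem singular_system_exists:
  fixes T :: "'a::complex_hilbert_space \<Rightarrow> 'a"
  assumes inf: "\<not> (\<exists>B::'a set. finite B \<and> cvec.span B = UNIV)" and T: "compact_operator T"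
  obtains e s where "singular_system T e s"
proof -
  define M where "M f n = {x. \<forall>j\<in>{..<n}. cinner x (f j) = 0}" for f :: "nat \<Rightarrow> 'a" and n
  \<comment> \<open>\<open>P f n u\<close> depends on \<open>f\<close> only below \<open>n\<close>,
    as dependent choice along the naturals demands.\<close>
  define P where "P f n u \<longleftrightarrow> u \<in> M f n \<and> norm u = 1 \<and>
    (\<forall>y\<in>M f n. norm (T y) \<le> norm (T u) * norm y)" for f n u
  have orthonormal_P: "cinner (f i) (f j) = (if i = j then 1 else 0)"
    if "P f i (f i)" "P f j (f j)" for f i j
    using that cinner_eq_0_commute[of "f i" "f j"]
    by (cases i j rule: linorder_cases) (auto simp: P_def M_def cinner_self)
  have "\<exists>e. \<forall>n. P e n (e n)"
  proof (rule dependent_wellorder_choice)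
    fix r and f g :: "nat \<Rightarrow> 'a" and n
    assume "\<And>m. m < n \<Longrightarrow> f m = g m"
    then have "M f n = M g n" by (auto simp: M_def)
    then show "P f n r = P g n r" by (simp add: P_def)
  next
    fix n and f :: "nat \<Rightarrow> 'a"
    assume IH: "\<And>m. m < n \<Longrightarrow> P f m (f m)"
    obtain x where x: "x \<noteq> 0" "x \<in> M f n"
    proof (rule exists_orthogonal_vector[OF inf])
      show "cinner (f i) (f j) = (if i = j then 1 else 0)" if "i < n" "j < n" for i j
        by (rule orthonormal_P) (use that in \<open>auto intro: IH\<close>)
    qed (use that in \<open>auto simp: M_def\<close>)
    have M: "cvec.subspace (M f n)" "closed (M f n)"
      unfolding M_def by (rule subspace_orthogonal_complement closed_orthogonal_complement)+
    obtain u where "u \<in> M f n" "norm u = 1" "\<And>y. y \<in> M f n \<Longrightarrow> norm (T y) \<le> norm (T u) * norm y"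
      using compact_operator_attains_norm[OF T M x(2,1)] by blast
    then show "\<exists>u. P f n u" unfolding P_def by blast
  qed
  then obtain e where e: "\<And>n. P e n (e n)" by blast
  define s where "s n = norm (T (e n))" for n
  have on: "orthonormal e" using e orthonormal_P by (simp add: orthonormal_def)
  have le: "norm (T y) \<le> s n * norm y" if "y \<in> M e n" for n y
    using e[of n] that by (simp add: P_def s_def)
  have "decseq s"
  proof (rule decseq_SucI)
    fix n
    have "e (Suc n) \<in> M e n" using e[of "Suc n"] by (auto simp: P_def M_def)
    from le[OF this] show "s (Suc n) \<le> s n"
      by (simp add: s_def[of "Suc n"] orthonormal_norm[OF on])
  qed
  have inner_M: "cinner (T (e n)) (T y) = (s n)\<^sup>2 * cinner (e n) y" if "y \<in> M e n" for n y
    unfolding s_def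
    by (rule norm_maximiser_cinner[OF T _ _ _ _ that])
      (use e[of n] in \<open>auto simp: P_def M_def subspace_orthogonal_complement\<close>)
  \<comment> \<open>The vector with the larger index lies in the complement belonging to the smaller
    one, where the maximality identity holds; conjugate symmetry covers the other order.\<close>
  have inner_e: "cinner (T (e n)) (T (e m)) = (if n = m then (s n)\<^sup>2 else 0)" for n m
  proof (cases "n \<le> m")
    case True
    then have "e m \<in> M e n" by (auto simp: M_def orthonormalD[OF on])
    from inner_M[OF this] show ?thesis by (simp add: orthonormalD[OF on])
  next
    case False
    then have "e n \<in> M e m" by (auto simp: M_def orthonormalD[OF on])
    from inner_M[OF this] False show ?thesis
      by (auto simp: orthonormalD[OF on] cinner_eq_0_commute[of "T (e n)"])
  qed
  \<comment> \<open>So far the identity is known only for \<open>y\<close> orthogonal to the earlier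
    vectors. The projection of a general \<open>y\<close> onto those contributes zero to both
    sides.\<close>
  have inner: "cinner (T (e n)) (T y) = (s n)\<^sup>2 * cinner (e n) y" for n y
  proof -
    let ?P = "\<Sum>j<n. cinner y (e j) *\<^sub>C e j"
    have "y - ?P \<in> M e n"
      using cinner_sum_orthonormal[OF on, of "{..<n}" "\<lambda>j. cinner y (e j)"]
      by (simp add: M_def cinner_diff_left)
    moreover have "cinner (e n) ?P = 0"
      by (auto simp: cinner_sum_right cinner_scaleC_right orthonormalD[OF on] intro!: sum.neutral)
    moreover have "T ?P = (\<Sum>j<n. cinner y (e j) *\<^sub>C T (e j))"
      using bounded_linear_compact_operator[OF T]
      by (simp add: linear_sum bounded_linear.linear compact_operator_scaleC[OF T])
    then have "cinner (T (e n)) (T ?P) = 0"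
      by (auto simp: cinner_sum_right cinner_scaleC_right inner_e intro!: sum.neutral)
    moreover have "T y = T (y - ?P) + T ?P"
      by (simp flip: compact_operator_add[OF T])
    ultimately show ?thesis
      using inner_M[of "y - ?P" n] by (simp only: cinner_add_right cinner_diff_right) simp
  qed
  have "s \<longlonglongrightarrow> 0"
  proof -
    obtain \<sigma> where \<sigma>: "s \<longlonglongrightarrow> \<sigma>" "\<And>n. \<sigma> \<le> s n"
      using decseq_convergent[OF \<open>decseq s\<close>, of 0] by (auto simp: s_def)
    have "\<sigma> \<ge> 0" by (rule LIMSEQ_le_const[OF \<sigma>(1)]) (simp add: s_def)
    \<comment> \<open>With a positive limit the mutually orthogonal images \<open>T (e n)\<close>
      would stay at distance at least \<open>\<sigma>\<close> from each other, so no subsequence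
      could be Cauchy, against compactness.\<close>
    moreover have False if "\<sigma> > 0"
    proof -
      obtain w r where r: "strict_mono r" and w: "(\<lambda>k. T (e (r k))) \<longlonglongrightarrow> w"
        by (rule compact_operator_convergent_subseq[OF T, of e]) (simp_all add: orthonormal_norm[OF on])
      from LIMSEQ_imp_Cauchy[OF w] \<open>\<sigma> > 0\<close> obtain N
        where N: "\<And>j k. j \<ge> N \<Longrightarrow> k \<ge> N \<Longrightarrow> dist (T (e (r j))) (T (e (r k))) < \<sigma>"
        using metric_CauchyD by blast
      let ?a = "r N" and ?b = "r (Suc N)"
      have "?a \<noteq> ?b" using r strict_mono_eq by fastforce
      have "(norm (T (e ?a) - T (e ?b)))\<^sup>2 < \<sigma>\<^sup>2"
        using N[of N "Suc N"] \<open>\<sigma> > 0\<close> by (intro power_strict_mono) (auto simp: dist_norm)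
      moreover have "(norm (T (e ?a) - T (e ?b)))\<^sup>2 = (s ?a)\<^sup>2 + (s ?b)\<^sup>2"
        using \<open>?a \<noteq> ?b\<close> by (simp add: norm_diff_sq inner_e s_def)
      moreover have "\<sigma>\<^sup>2 \<le> (s ?a)\<^sup>2"
        using \<sigma>(2) \<open>\<sigma> > 0\<close> by (intro power_mono) auto
      ultimately show False by (smt (verit) zero_le_power2)
    qed
    ultimately show ?thesis using \<sigma>(1) by (cases "\<sigma> = 0") auto
  qed
  moreover have "norm (T y) \<le> s n * norm y" if "\<forall>j<n. cinner y (e j) = 0" for n y
    using that by (intro le) (simp add: M_def)
  moreover have "0 \<le> s n" for n by (simp add: s_def)
  ultimately have "singular_system T e s"
    unfolding singular_system_def using on \<open>decseq s\<close> inner[unfolded of_real_power] by blast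
  then show ?thesis by (rule that)
qed

section \<open>Singular values and the Ky Fan inequality\<close>

text \<open>The remainder \<open>x - P M\<close> is orthogonal to the first \<open>M\<close>
  singular vectors, so \<open>T\<close> maps it to norm at most \<open>s M * norm x\<close>, which
  tends to zero.\<close>

lemma singular_system_expansion:
  assumes ss: "singular_system T e s" and T: "compact_operator T"
  shows "(\<lambda>M. \<Sum>m<M. cinner x (e m) *\<^sub>C T (e m)) \<longlonglongrightarrow> T x"
proof -
  have e: "orthonormal e" using ss by (simp add: singular_system_def)
  define P where "P M = (\<Sum>m<M. cinner x (e m) *\<^sub>C e m)" for M
  have TP: "T (P M) = (\<Sum>m<M. cinner x (e m) *\<^sub>C T (e m))" for M
    using bounded_linear_compact_operator[OF T]
    by (simp add: P_def linear_sum bounded_linear.linear compact_operator_scaleC[OF T])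
  have perp: "cinner (x - P M) (e j) = 0" if "j < M" for j M
    using that by (simp add: P_def cinner_diff_left cinner_sum_orthonormal[OF e])
  have "norm (x - P M) \<le> norm x" for M
  proof -
    have "cinner (x - P M) (\<Sum>m<M. cinner x (e m) *\<^sub>C e m) = 0"
      unfolding cinner_sum_right cinner_scaleC_right
      by (intro sum.neutral) (simp add: perp)
    then have "cinner (x - P M) (P M) = 0"
      by (simp only: P_def)
    then have "(norm x)\<^sup>2 = (norm (x - P M))\<^sup>2 + (norm (P M))\<^sup>2"
      using norm_add_sq[of "x - P M" "P M"] by simp
    then have "(norm (x - P M))\<^sup>2 \<le> (norm x)\<^sup>2"
      by (simp only: le_add_same_cancel1 zero_le_power2)
    then show ?thesis by (rule power2_le_imp_le) simp
  qed
  then have bound: "norm (T (P M) - T x) \<le> s M * norm x" for M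
  proof -
    have "T x = T (x - P M) + T (P M)"
      by (simp flip: compact_operator_add[OF T])
    then have "norm (T (P M) - T x) = norm (T (x - P M))"
      by simp
    also have "\<dots> \<le> s M * norm (x - P M)"
      using ss perp by (auto simp: singular_system_def)
    also have "\<dots> \<le> s M * norm x"
      using ss \<open>norm (x - P M) \<le> norm x\<close> by (auto simp: singular_system_def intro: mult_left_mono)
    finally show ?thesis .
  qed
  have "(\<lambda>M. s M * norm x) \<longlonglongrightarrow> 0"
    using ss by (auto simp: singular_system_def intro: tendsto_mult_left_zero)
  then have "(\<lambda>M. T (P M) - T x) \<longlonglongrightarrow> 0"
    by (rule Lim_null_comparison[rotated]) (simp add: bound always_eventually)
  then show ?thesis
    unfolding TP by (simp add: LIM_zero_iff)
qed

lemma singular_system_left_vectors: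
  assumes ss: "singular_system T e s"
  obtains h where "\<And>n. T (e n) = s n *\<^sub>R h n" and "\<And>n. cinner (T (e n)) (h n) = s n"
    and "\<And>i j. i \<noteq> j \<Longrightarrow> cinner (h i) (h j) = 0" and "\<And>i. norm (h i) \<le> 1"
proof
  have e: "orthonormal e" and s: "0 \<le> s n"
    and inner: "cinner (T (e n)) (T y) = (s n)\<^sup>2 * cinner (e n) y" for n y
    using ss by (simp_all add: singular_system_def)
  \<comment> \<open>As \<open>inverse 0 = 0\<close>, \<open>h n\<close> is the zero vector when
    \<open>s n = 0\<close>; hence the bound \<open>1\<close> on the norms in place of
    equality.\<close>
  define h where "h n = inverse (s n) *\<^sub>R T (e n)" for n
  have "(norm (T (e n)))\<^sup>2 = (s n)\<^sup>2" for n
    using inner[of n "e n"]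
    by (simp add: norm_sq_eq_cinner orthonormalD[OF e] flip: of_real_power)
  then have norm_T: "norm (T (e n)) = s n" for n
    using s by (simp add: power2_eq_iff_nonneg)
  show "T (e n) = s n *\<^sub>R h n" for n
    using norm_T[of n] by (cases "s n = 0") (auto simp: h_def)
  show "cinner (T (e n)) (h n) = s n" for n
    by (cases "s n = 0")
      (simp_all add: h_def cinner_scaleR_right inner orthonormalD[OF e] power2_eq_square field_simps)
  show "cinner (h i) (h j) = 0" if "i \<noteq> j" for i j
    using that by (simp add: h_def cinner_scaleR_left cinner_scaleR_right inner orthonormalD[OF e])
  show "norm (h i) \<le> 1" for i
    by (cases "s i = 0") (simp_all add: h_def norm_T s)
qed

section \<open>The adjoint, and singular values as spectral data\<close>

lemma cadjoint_eqI:
  assumes "\<And>x y. cinner (T x) y = cinner x (S y)" shows "cadjoint T = S"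
  unfolding cadjoint_def
proof (rule the_equality)
  fix S' assume "\<forall>x y. cinner (T x) y = cinner x (S' y)"
  with assms have "cinner x (S' y - S y) = 0" for x y
    by (simp add: cinner_diff_right)
  then have "S' y - S y = 0" for y
    using cinner_self_eq_0_iff by blast
  then show "S' = S" by auto
qed (use assms in simp)

text \<open>As \<open>cadjoint\<close> is a definite description, an adjoint must be exhibited:
  \<open>y\<close> is sent to the sum of \<open>cinner y (T (e n)) *\<^sub>C e n\<close>. The
  coefficients have modulus \<open>s n * cmod (cinner y (h n))\<close>, so Bessel gives convergence,
  and pairing with \<open>x\<close> reproduces the expansion of \<open>T x\<close> term by
  term.\<close>

lemma cinner_cadjoint:
  assumes ss: "singular_system T e s" and T: "compact_operator T"
  shows "cinner (T x) y = cinner x (cadjoint T y)"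
proof -
  have e: "orthonormal e" and s: "decseq s" "\<And>n. 0 \<le> s n"
    using ss by (simp_all add: singular_system_def)
  obtain h where h: "\<And>n. T (e n) = s n *\<^sub>R h n" "\<And>i j. i \<noteq> j \<Longrightarrow> cinner (h i) (h j) = 0"
    "\<And>i. norm (h i) \<le> 1"
    using singular_system_left_vectors[OF ss] by metis
  define v where "v y n = cinner y (T (e n)) *\<^sub>C e n" for y n
  have "v y summable_on UNIV" for y
  proof (rule summable_on_orthogonal[where C = "(s 0)\<^sup>2 * (norm y)\<^sup>2"])
    show "cinner (v y i) (v y j) = 0" if "i \<noteq> j" for i j
      using that by (simp add: v_def cinner_scaleC_left cinner_scaleC_right orthonormalD[OF e])
    fix F :: "nat set" assume F: "finite F"
    have "(\<Sum>n\<in>F. (norm (v y n))\<^sup>2) = (\<Sum>n\<in>F. (s n)\<^sup>2 * (cmod (cinner y (h n)))\<^sup>2)"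
      by (simp add: v_def norm_scaleC orthonormal_norm[OF e] h(1) cinner_scaleR_right
          norm_mult power_mult_distrib)
    also have "\<dots> \<le> (\<Sum>n\<in>F. (s 0)\<^sup>2 * (cmod (cinner y (h n)))\<^sup>2)"
      using s decseqD[OF s(1), of 0] by (intro sum_mono mult_right_mono power_mono) auto
    also have "\<dots> \<le> (s 0)\<^sup>2 * (norm y)\<^sup>2"
      unfolding sum_distrib_left[symmetric]
      using F h by (intro mult_left_mono bessel_inequality) auto
    finally show "(\<Sum>n\<in>F. (norm (v y n))\<^sup>2) \<le> (s 0)\<^sup>2 * (norm y)\<^sup>2" .
  qed
  then have "(v y has_sum infsum (v y) UNIV) UNIV" for y
    by (rule has_sum_infsum)
  then have "v y sums infsum (v y) UNIV" for y
    by (rule has_sum_imp_sums)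
  then have "(\<lambda>n. cinner x (v y n)) sums cinner x (infsum (v y) UNIV)" for x y
    by (rule bounded_linear.sums[OF bounded_linear_cinner_right])
  moreover have "(\<lambda>n. cinner x (v y n)) sums cinner (T x) y" for x y
  proof -
    have "(\<lambda>M. cinner (\<Sum>m<M. cinner x (e m) *\<^sub>C T (e m)) y) \<longlonglongrightarrow> cinner (T x) y"
      by (intro bounded_linear.tendsto[OF bounded_linear_cinner_left]
          singular_system_expansion[OF ss T])
    moreover have "cinner x (v y m) = cinner (cinner x (e m) *\<^sub>C T (e m)) y" for m
      by (simp add: v_def cinner_scaleC_left cinner_scaleC_right cinner_commute[of "T (e m)"])
    ultimately show ?thesis
      by (simp add: sums_def cinner_sum_left)
  qed
  ultimately have adj: "cinner (T x) y = cinner x (infsum (v y) UNIV)" for x y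
    using sums_unique2 by blast
  then have "cadjoint T = (\<lambda>y. infsum (v y) UNIV)" by (rule cadjoint_eqI)
  with adj show ?thesis by simp
qed

lemma diagonal_cadjoint_comp:
  assumes ss: "singular_system T e s" and T: "compact_operator T"
  shows "diagonal e (\<lambda>n. (s n)\<^sup>2) (cadjoint T \<circ> T)"
proof -
  have inner: "cinner (T (e n)) (T y) = (s n)\<^sup>2 * cinner (e n) y" for n y
    using ss by (simp add: singular_system_def)
  have "cinner (cadjoint T (T x)) (e n) = (s n)\<^sup>2 * cinner x (e n)" for x n
  proof -
    have "cinner (cadjoint T (T x)) (e n) = cnj (cinner (T (e n)) (T x))"
      using cinner_cadjoint[OF ss T] cinner_commute by metis
    also have "\<dots> = (s n)\<^sup>2 * cinner x (e n)"
      by (simp add: inner cinner_commute[of x])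
    finally show ?thesis .
  qed
  moreover have "cinner (cadjoint T (T x)) y = 0" if "\<And>n. cinner y (e n) = 0" for x y
  proof -
    \<comment> \<open>A vector orthogonal to every \<open>e n\<close> is annihilated by
      \<open>T\<close>, because all \<open>s n\<close> bound \<open>T\<close> on it and
      \<open>s\<close> tends to zero. This gives the last clause of \<open>diagonal\<close>.\<close>
    have "norm (T y) \<le> s n * norm y" for n
      using ss that by (simp add: singular_system_def)
    moreover have "(\<lambda>n. s n * norm y) \<longlonglongrightarrow> 0"
      using ss by (auto simp: singular_system_def intro: tendsto_mult_left_zero)
    ultimately have "norm (T y) \<le> 0"
      by (meson LIMSEQ_le_const)
    then have "cinner y (cadjoint T (T x)) = 0"
      using cinner_cadjoint[OF ss T, of y "T x"] by simp
    then show ?thesis using cinner_eq_0_commute by blast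
  qed
  moreover have "(\<lambda>n. (s n)\<^sup>2) \<longlonglongrightarrow> 0"
    using ss tendsto_power[of s 0 sequentially 2] by (simp add: singular_system_def)
  moreover have "decseq (\<lambda>n. (s n)\<^sup>2)"
    using ss by (simp add: singular_system_def decseq_def power_mono)
  ultimately show ?thesis
    using ss by (simp add: diagonal_def singular_system_def)
qed

text \<open>The functional calculus is applied twice: \<open>sqrt\<close> turns the entries
  \<open>(s n)\<^sup>2\<close> into \<open>s n\<close>, and the power turns these into
  \<open>s n powr p\<close>. Monotonicity and limit of \<open>s\<close> are conclusions because the
  hypothesis gives them for the squares.\<close>

lemma eigval_seq_op_powr_abs:
  assumes D: "diagonal e (\<lambda>n. (s n)\<^sup>2) (cadjoint T \<circ> T)" and s: "\<And>n. 0 \<le> s n"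
    and p: "p > 0"
  shows "eigval_seq (op_powr (op_abs T) p) = (\<lambda>n. s n powr p)"
    and "decseq s" and "s \<longlonglongrightarrow> 0"
proof -
  have "(\<lambda>n. sqrt ((s n)\<^sup>2)) \<longlonglongrightarrow> 0"
    using tendsto_real_sqrt[of "\<lambda>n. (s n)\<^sup>2" 0] D by (simp add: diagonal_def)
  then have "diagonal e (\<lambda>n. sqrt ((s n)\<^sup>2)) (op_abs T)"
    unfolding op_abs_def by (intro diagonal_fun_calc[OF D]) (auto intro: mono_onI)
  then have abs: "diagonal e s (op_abs T)" by (simp add: s)
  then show "decseq s" and lim: "s \<longlonglongrightarrow> 0" by (simp_all add: diagonal_def)
  have "(\<lambda>n. s n powr p) \<longlonglongrightarrow> 0"
    by (rule tendsto_zero_powrI[OF lim tendsto_const]) (simp_all add: s p)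
  then have "diagonal e (\<lambda>n. s n powr p) (op_powr (op_abs T) p)"
    unfolding op_powr_def
    by (intro diagonal_fun_calc[OF abs]) (use p in \<open>auto intro!: mono_onI powr_mono2\<close>)
  then show "eigval_seq (op_powr (op_abs T) p) = (\<lambda>n. s n powr p)"
    by (rule eigval_seq_diagonal)
qed

section \<open>Ky Fan inequalities\<close>

text \<open>Bathtub principle: shifting weight to the first \<open>k\<close> indices, where
  \<open>s\<close> is at least \<open>s k\<close>, can only increase the sum.\<close>

lemma sum_decseq_weighted_le:
  fixes s w :: "nat \<Rightarrow> real"
  assumes s: "decseq s" "\<And>n. 0 \<le> s n" and w: "\<And>m. 0 \<le> w m" "\<And>m. w m \<le> 1"
    and total: "(\<Sum>m<M. w m) \<le> real k"
  shows "(\<Sum>m<M. s m * w m) \<le> (\<Sum>m<k. s m)"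
proof (cases "M \<le> k")
  case True
  have "(\<Sum>m<M. s m * w m) \<le> (\<Sum>m<M. s m)"
    by (intro sum_mono mult_left_le s w)
  also have "\<dots> \<le> (\<Sum>m<k. s m)"
    using True s(2) by (intro sum_mono2) auto
  finally show ?thesis .
next
  case False
  have ind: "(\<Sum>m<M. f m * of_bool (m < k)) = (\<Sum>m<k. f m)" for f :: "nat \<Rightarrow> real"
    using False by (intro sum.mono_neutral_cong_right) auto
  \<comment> \<open>The factors \<open>s m - s k\<close> and \<open>w m - of_bool (m < k)\<close>
    never have the same strict sign.\<close>
  have "s m * w m - s m * of_bool (m < k) \<le> s k * (w m - of_bool (m < k))" for m
  proof (cases "m < k")
    case True
    then have "s k \<le> s m" by (intro decseqD[OF s(1)]) simp
    then have "0 \<le> (s m - s k) * (1 - w m)" using w(2)[of m] by simp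
    with True show ?thesis by (simp add: algebra_simps)
  next
    case False
    then have "s m * w m \<le> s k * w m"
      using decseqD[OF s(1), of k m] w(1) by (intro mult_right_mono) auto
    with False show ?thesis by simp
  qed
  then have "(\<Sum>m<M. s m * w m - s m * of_bool (m < k)) \<le> (\<Sum>m<M. s k * (w m - of_bool (m < k)))"
    by (intro sum_mono)
  also have "\<dots> = s k * ((\<Sum>m<M. w m) - real k)"
    using ind[of "\<lambda>_. 1"] by (simp add: sum_subtractf flip: sum_distrib_left)
  also have "\<dots> \<le> 0"
    using total s(2)[of k] by (simp add: mult_nonneg_nonpos)
  finally show ?thesis by (simp add: sum_subtractf ind)
qed

text \<open>Expanding \<open>T\<close> in singular vectors and splitting each product by AM-GM turns the left side
  into \<open>\<Sum>m. s\<^sub>m w\<^sub>m\<close>; Bessel gives \<open>w\<^sub>m \<le> 1\<close> in one direction and \<open>\<Sum>m. w\<^sub>m \<le> k\<close> in the other.\<close>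

lemma ky_fan_bound:
  assumes ss: "singular_system T e s" and T: "compact_operator T"
    and u: "\<And>i j. i \<noteq> j \<Longrightarrow> cinner (u i) (u j) = 0" "\<And>i. norm (u i) \<le> 1"
    and v: "\<And>i j. i \<noteq> j \<Longrightarrow> cinner (v i) (v j) = 0" "\<And>i. norm (v i) \<le> 1"
  shows "Re (\<Sum>n<k. cinner (T (u n)) (v n)) \<le> (\<Sum>n<k. s n)"
proof -
  have e: "orthonormal e" and s: "decseq s" "\<And>n. 0 \<le> s n"
    using ss by (simp_all add: singular_system_def)
  obtain h where h: "\<And>n. T (e n) = s n *\<^sub>R h n" "\<And>i j. i \<noteq> j \<Longrightarrow> cinner (h i) (h j) = 0"
    "\<And>i. norm (h i) \<le> 1"
    using singular_system_left_vectors[OF ss] by metis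
  define w where
    "w m = (\<Sum>n<k. ((cmod (cinner (u n) (e m)))\<^sup>2 + (cmod (cinner (h m) (v n)))\<^sup>2) / 2)" for m
  have w_nonneg: "0 \<le> w m" for m unfolding w_def by (intro sum_nonneg) simp
  have cmod_commute: "cmod (cinner x y) = cmod (cinner y x)" for x y :: 'a
    by (metis cinner_commute complex_mod_cnj)
  have norm_sq_le: "x\<^sup>2 \<le> 1" if "0 \<le> x" "x \<le> 1" for x :: real
    using that by (simp add: power_le_one)
  have w_le: "w m \<le> 1" for m
  proof -
    have "(\<Sum>n<k. (cmod (cinner (e m) (u n)))\<^sup>2) \<le> (norm (e m))\<^sup>2"
      by (intro bessel_inequality u) auto
    moreover have "(\<Sum>n<k. (cmod (cinner (h m) (v n)))\<^sup>2) \<le> (norm (h m))\<^sup>2"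
      by (intro bessel_inequality v) auto
    ultimately show ?thesis
      using norm_sq_le[OF norm_ge_zero h(3), of m] orthonormal_norm[OF e, of m]
      by (simp add: w_def sum.distrib cmod_commute[of "u _"] flip: sum_divide_distrib)
  qed
  have w_sum: "(\<Sum>m<M. w m) \<le> real k" for M
  proof -
    have "(\<Sum>m<M. w m) = (\<Sum>n<k. ((\<Sum>m<M. (cmod (cinner (u n) (e m)))\<^sup>2) +
        (\<Sum>m<M. (cmod (cinner (v n) (h m)))\<^sup>2)) / 2)"
      unfolding w_def
      by (subst sum.swap) (simp add: sum.distrib cmod_commute[of "h _"] flip: sum_divide_distrib)
    also have "\<dots> \<le> (\<Sum>n<k. 1)"
    proof (rule sum_mono)
      fix n
      have "(\<Sum>m<M. (cmod (cinner (u n) (e m)))\<^sup>2) \<le> (norm (u n))\<^sup>2"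
        by (intro bessel_inequality) (auto simp: orthonormalD[OF e] orthonormal_norm[OF e])
      moreover have "(\<Sum>m<M. (cmod (cinner (v n) (h m)))\<^sup>2) \<le> (norm (v n))\<^sup>2"
        by (intro bessel_inequality h) auto
      ultimately show "((\<Sum>m<M. (cmod (cinner (u n) (e m)))\<^sup>2) +
          (\<Sum>m<M. (cmod (cinner (v n) (h m)))\<^sup>2)) / 2 \<le> 1"
        using norm_sq_le[OF norm_ge_zero u(2), of n] norm_sq_le[OF norm_ge_zero v(2), of n] by simp
    qed
    finally show ?thesis by simp
  qed
  have partial: "Re (\<Sum>n<k. cinner (\<Sum>m<M. cinner (u n) (e m) *\<^sub>C T (e m)) (v n)) \<le> (\<Sum>n<k. s n)" for M
  proof -
    have "Re (\<Sum>n<k. cinner (\<Sum>m<M. cinner (u n) (e m) *\<^sub>C T (e m)) (v n)) =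
        (\<Sum>m<M. \<Sum>n<k. Re (s m * (cinner (u n) (e m) * cinner (h m) (v n))))"
      by (subst sum.swap)
        (simp add: cinner_sum_left cinner_scaleC_left h(1) cinner_scaleR_left mult_ac)
    also have "\<dots> \<le> (\<Sum>m<M. \<Sum>n<k. s m *
        (((cmod (cinner (u n) (e m)))\<^sup>2 + (cmod (cinner (h m) (v n)))\<^sup>2) / 2))"
    proof (intro sum_mono)
      fix m n
      let ?x = "cinner (u n) (e m)" and ?y = "cinner (h m) (v n)"
      have "Re (?x * ?y) \<le> cmod ?x * cmod ?y"
        using complex_Re_le_cmod[of "?x * ?y"] by (simp add: norm_mult)
      also have "\<dots> \<le> ((cmod ?x)\<^sup>2 + (cmod ?y)\<^sup>2) / 2"
        using sum_squares_bound[of "cmod ?x" "cmod ?y"] by simp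
      finally have "s m * Re (?x * ?y) \<le> s m * (((cmod ?x)\<^sup>2 + (cmod ?y)\<^sup>2) / 2)"
        using s(2) by (rule mult_left_mono)
      then show "Re (s m * (?x * ?y)) \<le> s m * (((cmod ?x)\<^sup>2 + (cmod ?y)\<^sup>2) / 2)"
        by simp
    qed
    also have "\<dots> = (\<Sum>m<M. s m * w m)"
      by (simp add: w_def sum_distrib_left)
    also have "\<dots> \<le> (\<Sum>n<k. s n)"
      by (rule sum_decseq_weighted_le[OF s w_nonneg w_le w_sum])
    finally show ?thesis .
  qed
  \<comment> \<open>The bound on the truncations is uniform in \<open>M\<close>, so it survives the
    limit of the singular expansion.\<close>
  have "(\<lambda>M. Re (\<Sum>n<k. cinner (\<Sum>m<M. cinner (u n) (e m) *\<^sub>C T (e m)) (v n)))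
      \<longlonglongrightarrow> Re (\<Sum>n<k. cinner (T (u n)) (v n))"
    by (intro tendsto_Re tendsto_sum bounded_linear.tendsto[OF bounded_linear_cinner_left]
        singular_system_expansion[OF ss T])
  then show ?thesis
    by (rule LIMSEQ_le_const2) (use partial in blast)
qed

text \<open>Pairing the sum operator with its own right and left singular vectors attains the sum of
  its singular values; the same vectors are admissible in the Ky Fan bound for each summand.\<close>

lemma ky_fan_triangle:
  assumes a: "singular_system a ea sa" "compact_operator a"
    and b: "singular_system b eb sb" "compact_operator b"
    and c: "singular_system (\<lambda>x. a x + b x) e s"
  shows "(\<Sum>n<k. s n) \<le> (\<Sum>n<k. sa n + sb n)"
proof -
  obtain h where h: "\<And>n. cinner (a (e n) + b (e n)) (h n) = s n"
    "\<And>i j. i \<noteq> j \<Longrightarrow> cinner (h i) (h j) = 0" "\<And>i. norm (h i) \<le> 1"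
    using singular_system_left_vectors[OF c] by metis
  have e: "orthonormal e" using c by (simp add: singular_system_def)
  then have e': "\<And>i j. i \<noteq> j \<Longrightarrow> cinner (e i) (e j) = 0" "\<And>i. norm (e i) \<le> 1"
    by (simp_all add: orthonormalD orthonormal_norm)
  have "(\<Sum>n<k. s n) = Re (\<Sum>n<k. cinner (a (e n) + b (e n)) (h n))"
    by (simp add: h(1))
  also have "\<dots> = Re (\<Sum>n<k. cinner (a (e n)) (h n)) + Re (\<Sum>n<k. cinner (b (e n)) (h n))"
    by (simp add: cinner_add_left sum.distrib)
  also have "\<dots> \<le> (\<Sum>n<k. sa n) + (\<Sum>n<k. sb n)"
    by (intro add_mono ky_fan_bound[OF a e' h(2,3)] ky_fan_bound[OF b e' h(2,3)])
  finally show ?thesis by (simp add: sum.distrib)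
qed

section \<open>Inequalities for real sequences\<close>

lemma powr_above_tangent:
  fixes u z p :: real
  assumes "u \<ge> 0" and "z \<ge> 0" and p: "p \<ge> 1"
  shows "z powr p + p * z powr (p - 1) * (u - z) \<le> u powr p"
proof -
  \<comment> \<open>The tangent argument lives on positive numbers. For \<open>z = 0\<close> the
    slope is zero, since \<open>0 powr r = 0\<close> even for \<open>r = 0\<close>, which occurs
    when \<open>p = 1\<close>; for \<open>u = 0\<close> the left side is
    \<open>(1 - p) * z powr p\<close>.\<close>
  consider "z = 0" | "z > 0" "u = 0" | "z > 0" "u > 0" using assms by linarith
  then show ?thesis
  proof cases
    case 2
    then have "z powr (p - 1) * z = z powr p"
      using powr_mult_base[of z "p - 1"] by (simp add: mult.commute)
    with 2 p show ?thesis
      by (simp add: mult.assoc)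
  next
    case 3
    have "u powr p - z powr p \<ge> (p * z powr (p - 1)) * (u - z)"
    proof (rule convex_on_imp_above_tangent[where A = "{0<..}"])
      show "convex_on {0<..} (\<lambda>x. x powr p)"
        using p by (rule powr_convex)
      show "((\<lambda>x. x powr p) has_real_derivative p * z powr (p - 1)) (at z within {0<..})"
        using 3 by (auto intro!: derivative_eq_intros)
    qed (use 3 in \<open>auto simp: interior_open\<close>)
    then show ?thesis by simp
  qed simp
qed

text \<open>The tangent inequalities at the mean \<open>m\<close>, weighted with \<open>t\<close>
  and \<open>1 - t\<close>: the linear terms cancel.\<close>

lemma powr_convex_combination:
  fixes a b p t :: real
  assumes ab: "a \<ge> 0" "b \<ge> 0" and p: "p \<ge> 1" and t: "0 \<le> t" "t \<le> 1"
  shows "(t * a + (1 - t) * b) powr p \<le> t * a powr p + (1 - t) * b powr p"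
proof -
  define m where "m = t * a + (1 - t) * b"
  have m: "m \<ge> 0" using ab t by (simp add: m_def)
  have "t * (m powr p + p * m powr (p - 1) * (a - m)) +
      (1 - t) * (m powr p + p * m powr (p - 1) * (b - m)) \<le> t * a powr p + (1 - t) * b powr p"
    using t by (intro add_mono mult_left_mono powr_above_tangent ab m p) auto
  moreover have "t * (m powr p + p * m powr (p - 1) * (a - m)) +
      (1 - t) * (m powr p + p * m powr (p - 1) * (b - m)) =
      m powr p + p * m powr (p - 1) * (t * a + (1 - t) * b - m)"
    by (simp add: algebra_simps)
  ultimately show ?thesis by (simp add: m_def)
qed

text \<open>Abel summation as an induction: replacing the coefficient \<open>g N\<close> by the
  smaller \<open>g (Suc N)\<close> lowers its product with a nonnegative partial sum.\<close>

lemma sum_decseq_mult_ge: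
  fixes g d :: "nat \<Rightarrow> real"
  assumes g: "decseq g" and d: "\<And>k. k \<le> N \<Longrightarrow> 0 \<le> (\<Sum>n<Suc k. d n)"
  shows "g N * (\<Sum>n<Suc N. d n) \<le> (\<Sum>n<Suc N. g n * d n)"
  using d
proof (induction N)
  case (Suc N)
  have "g (Suc N) * (\<Sum>n<Suc N. d n) \<le> g N * (\<Sum>n<Suc N. d n)"
    using Suc.prems[of N] decseqD[OF g, of N "Suc N"] by (intro mult_right_mono) auto
  also have "\<dots> \<le> (\<Sum>n<Suc N. g n * d n)"
    using Suc by (meson le_SucI)
  finally show ?case by (simp add: algebra_simps)
qed simp

text \<open>Tangents at \<open>z n\<close> reduce the claim to a sum of \<open>u n - z n\<close>
  weighted by \<open>g n\<close>, the product of \<open>w n\<close> and the slope. These weights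
  decrease because \<open>w\<close> and \<open>z\<close> do, and the partial sums of
  \<open>u n - z n\<close> are nonnegative, so Abel summation applies.\<close>

lemma weak_majorization_powr:
  fixes z u w :: "nat \<Rightarrow> real"
  assumes z: "decseq z" "\<And>n. 0 \<le> z n" and u: "\<And>n. 0 \<le> u n"
    and w: "decseq w" "\<And>n. 0 \<le> w n" and p: "p \<ge> 1"
    and le: "\<And>k. (\<Sum>n<k. z n) \<le> (\<Sum>n<k. u n)"
  shows "(\<Sum>n<N. w n * z n powr p) \<le> (\<Sum>n<N. w n * u n powr p)"
proof (cases N)
  case (Suc M)
  define g where "g n = w n * (p * z n powr (p - 1))" for n
  have g: "decseq g"
    unfolding decseq_def g_def using z w p
    by (auto simp: decseq_def intro!: mult_mono powr_mono2)
  have g0: "0 \<le> g n" for n using w(2)[of n] p by (simp add: g_def)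
  have partial: "0 \<le> (\<Sum>n<k. u n - z n)" for k
    using le[of k] by (simp add: sum_subtractf)
  have "0 \<le> g M * (\<Sum>n<Suc M. u n - z n)"
    by (intro mult_nonneg_nonneg g0 partial)
  also have "\<dots> \<le> (\<Sum>n<N. g n * (u n - z n))"
    unfolding Suc by (rule sum_decseq_mult_ge[OF g partial])
  also have "\<dots> \<le> (\<Sum>n<N. w n * u n powr p - w n * z n powr p)"
  proof (rule sum_mono)
    fix n
    have "w n * (z n powr p + p * z n powr (p - 1) * (u n - z n)) \<le> w n * u n powr p"
      by (intro mult_left_mono powr_above_tangent u z w p)
    then show "g n * (u n - z n) \<le> w n * u n powr p - w n * z n powr p"
      by (simp add: g_def algebra_simps)
  qed
  finally show ?thesis by (simp add: sum_subtractf)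
qed simp

text \<open>With \<open>A\<close> and \<open>B\<close> the two norms, \<open>x i + y i\<close> is
  \<open>A + B\<close> times a convex combination of \<open>x i / A\<close> and
  \<open>y i / B\<close> with weight \<open>t = A / (A + B)\<close>. By convexity of the power, and
  since both normalised sums equal \<open>1\<close>, the total is at most
  \<open>(A + B) powr p\<close>.\<close>

lemma minkowski_weighted_sum:
  fixes x y w :: "'i \<Rightarrow> real"
  assumes I: "finite I" and x: "\<And>i. 0 \<le> x i" and y: "\<And>i. 0 \<le> y i" and w: "\<And>i. 0 \<le> w i"
    and p: "p \<ge> 1"
  shows "(\<Sum>i\<in>I. w i * (x i + y i) powr p) powr (1 / p) \<le>
    (\<Sum>i\<in>I. w i * x i powr p) powr (1 / p) + (\<Sum>i\<in>I. w i * y i powr p) powr (1 / p)"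
proof -
  define X where "X = (\<Sum>i\<in>I. w i * x i powr p)"
  define Y where "Y = (\<Sum>i\<in>I. w i * y i powr p)"
  define A where "A = X powr (1 / p)"
  define B where "B = Y powr (1 / p)"
  have X: "0 \<le> X" and Y: "0 \<le> Y"
    unfolding X_def Y_def by (auto intro!: sum_nonneg mult_nonneg_nonneg w)
  \<comment> \<open>A vanishing norm cannot be normalised; but then at each index the weight or the
    entry is zero, so the family drops out.\<close>
  have zero: "(\<Sum>i\<in>I. w i * (f i + g i) powr p) = (\<Sum>i\<in>I. w i * g i powr p)"
    if "(\<Sum>i\<in>I. w i * f i powr p) = 0" for f g :: "'i \<Rightarrow> real"
  proof (rule sum.cong)
    fix i assume "i \<in> I"
    with that have "w i * f i powr p = 0"
      using sum_nonneg_eq_0_iff[OF I, of "\<lambda>i. w i * f i powr p"] w by simp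
    then show "w i * (f i + g i) powr p = w i * g i powr p" by auto
  qed simp
  have "(\<Sum>i\<in>I. w i * (x i + y i) powr p) powr (1 / p) \<le> A + B"
  proof -
    consider "X = 0" | "Y = 0" | "X > 0" "Y > 0" using X Y by linarith
    then show ?thesis
    proof cases
      case 1
      then have "(\<Sum>i\<in>I. w i * (x i + y i) powr p) = Y"
        unfolding Y_def by (intro zero) (simp add: X_def)
      then show ?thesis by (simp add: A_def B_def)
    next
      case 2
      then have "(\<Sum>i\<in>I. w i * (y i + x i) powr p) = X"
        unfolding X_def by (intro zero) (simp add: Y_def)
      then show ?thesis by (simp add: A_def B_def add.commute)
    next
      case 3
      then have AB: "A > 0" "B > 0" by (auto simp: A_def B_def)
      have Ap: "A powr p = X" and Bp: "B powr p = Y"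
        using 3 p by (auto simp: A_def B_def powr_powr)
      define t where "t = A / (A + B)"
      have t: "0 \<le> t" "t \<le> 1" "1 - t = B / (A + B)" using AB by (auto simp: t_def field_simps)
      have "(\<Sum>i\<in>I. w i * (x i + y i) powr p) \<le>
          (\<Sum>i\<in>I. w i * ((A + B) powr p * (t * (x i powr p / X) + (1 - t) * (y i powr p / Y))))"
      proof (intro sum_mono mult_left_mono w)
        fix i
        have "(A + B) * t = A" "(A + B) * (1 - t) = B"
          unfolding t(3) using AB by (simp_all add: t_def)
        then have "(A + B) * (t * (x i / A) + (1 - t) * (y i / B)) = A * (x i / A) + B * (y i / B)"
          by (simp only: distrib_left mult.assoc[symmetric])
        then have "x i + y i = (A + B) * (t * (x i / A) + (1 - t) * (y i / B))"
          using AB by simp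
        then have "(x i + y i) powr p = (A + B) powr p * (t * (x i / A) + (1 - t) * (y i / B)) powr p"
          using AB t x y by (simp add: powr_mult)
        also have "\<dots> \<le> (A + B) powr p * (t * (x i / A) powr p + (1 - t) * (y i / B) powr p)"
          using AB x y by (intro mult_left_mono powr_convex_combination t p) auto
        finally show "(x i + y i) powr p \<le>
            (A + B) powr p * (t * (x i powr p / X) + (1 - t) * (y i powr p / Y))"
          using AB x y by (simp add: powr_divide Ap Bp)
      qed
      also have "\<dots> = (\<Sum>i\<in>I. ((A + B) powr p * t / X) * (w i * x i powr p) +
          ((A + B) powr p * (1 - t) / Y) * (w i * y i powr p))"
        by (intro sum.cong) (simp_all add: algebra_simps)
      also have "\<dots> = ((A + B) powr p * t / X) * X + ((A + B) powr p * (1 - t) / Y) * Y"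
        unfolding sum.distrib sum_distrib_left[symmetric] X_def[symmetric] Y_def[symmetric] ..
      also have "\<dots> = (A + B) powr p" using 3 by (simp add: right_diff_distrib)
      finally have "(\<Sum>i\<in>I. w i * (x i + y i) powr p) powr (1 / p) \<le> ((A + B) powr p) powr (1 / p)"
        using p by (intro powr_mono2 sum_nonneg mult_nonneg_nonneg w) auto
      then show ?thesis using AB p by (simp add: powr_powr)
    qed
  qed
  then show ?thesis by (simp add: A_def B_def X_def Y_def)
qed

section \<open>Abel summation for the Choquet trace\<close>

lemma sum_abel_summation:
  fixes d \<alpha> :: "nat \<Rightarrow> real"
  assumes "\<alpha> 0 = 0"
  shows "(\<Sum>n<N. (d n - d (Suc n)) * \<alpha> (Suc n)) = (\<Sum>n<N. (\<alpha> (Suc n) - \<alpha> n) * d n) - d N * \<alpha> N"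
  by (induction N) (simp_all add: assms algebra_simps)

text \<open>Dropping the boundary term \<open>d N * \<alpha> N\<close> gives one inequality. For the
  other, monotonicity of \<open>\<alpha>\<close> and telescoping bound
  \<open>(d N - d M) * \<alpha> N\<close> by the terms of \<open>L\<close> from \<open>N\<close> to
  \<open>M\<close>, and \<open>M\<close> tends to infinity. Both sides may be infinite.\<close>

lemma suminf_abel_summation:
  fixes d \<alpha> :: "nat \<Rightarrow> real"
  assumes \<alpha>: "mono \<alpha>" "\<alpha> 0 = 0" and d: "decseq d" "\<And>n. 0 \<le> d n" "d \<longlonglongrightarrow> 0"
  shows "(\<Sum>n. ennreal ((d n - d (Suc n)) * \<alpha> (Suc n))) = (\<Sum>n. ennreal ((\<alpha> (Suc n) - \<alpha> n) * d n))"
proof (rule antisym)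
  have \<alpha>_nonneg: "0 \<le> \<alpha> n" for n using monoD[OF \<alpha>(1), of 0 n] \<alpha>(2) by simp
  have \<alpha>_diff: "0 \<le> \<alpha> (Suc n) - \<alpha> n" for n using monoD[OF \<alpha>(1), of n "Suc n"] by simp
  have d_diff: "0 \<le> d n - d (Suc n)" for n using decseqD[OF d(1), of n "Suc n"] by simp
  define L where "L n = (d n - d (Suc n)) * \<alpha> (Suc n)" for n
  define R where "R n = (\<alpha> (Suc n) - \<alpha> n) * d n" for n
  have L: "0 \<le> L n" and R: "0 \<le> R n" for n
    using d_diff \<alpha>_diff \<alpha>_nonneg d(2) by (simp_all add: L_def R_def)
  have abel: "sum L {..<N} = sum R {..<N} - d N * \<alpha> N" for N
    unfolding L_def R_def by (rule sum_abel_summation[of \<alpha> d N, OF \<alpha>(2)])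
  have "(\<Sum>n. ennreal (L n)) \<le> (\<Sum>n. ennreal (R n))"
  proof (rule suminf_le_const)
    fix N
    have "(\<Sum>n<N. ennreal (L n)) \<le> (\<Sum>n<N. ennreal (R n))"
      using abel[of N] d(2)[of N] \<alpha>_nonneg[of N] L R
      by (simp add: sum_ennreal ennreal_leI)
    also have "\<dots> \<le> (\<Sum>n. ennreal (R n))" by (rule sum_le_suminf) auto
    finally show "(\<Sum>n<N. ennreal (L n)) \<le> (\<Sum>n. ennreal (R n))" .
  qed simp
  then show "(\<Sum>n. ennreal ((d n - d (Suc n)) * \<alpha> (Suc n))) \<le> (\<Sum>n. ennreal ((\<alpha> (Suc n) - \<alpha> n) * d n))"
    by (simp add: L_def R_def)
  have "(\<Sum>n. ennreal (R n)) \<le> (\<Sum>n. ennreal (L n))"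
  proof (rule suminf_le_const)
    fix N
    have "ennreal (sum R {..<N} - d M * \<alpha> N) \<le> (\<Sum>n. ennreal (L n))" if "M \<ge> N" for M
    proof -
      have "(\<Sum>n\<in>{N..<M}. d n - d (Suc n)) = d N - d M"
        using sum_Suc_diff'[OF that, of "\<lambda>n. - d n"] by simp
      then have "(d N - d M) * \<alpha> N = (\<Sum>n\<in>{N..<M}. (d n - d (Suc n)) * \<alpha> N)"
        by (simp flip: sum_distrib_right)
      also have "\<dots> \<le> sum L {N..<M}"
        unfolding L_def using d_diff monoD[OF \<alpha>(1)]
        by (intro sum_mono mult_left_mono) auto
      finally have "sum R {..<N} - d M * \<alpha> N \<le> sum L {..<N} + sum L {N..<M}"
        using abel[of N] by (simp add: algebra_simps)
      also have "\<dots> = sum L {..<M}"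
        using that by (metis lessThan_atLeast0 sum.atLeastLessThan_concat zero_le)
      finally have "ennreal (sum R {..<N} - d M * \<alpha> N) \<le> (\<Sum>n<M. ennreal (L n))"
        using L by (simp add: sum_ennreal ennreal_leI)
      also have "\<dots> \<le> (\<Sum>n. ennreal (L n))" by (rule sum_le_suminf) auto
      finally show ?thesis .
    qed
    moreover have "(\<lambda>M. ennreal (sum R {..<N} - d M * \<alpha> N)) \<longlonglongrightarrow> ennreal (sum R {..<N} - 0 * \<alpha> N)"
      by (intro tendsto_ennrealI tendsto_intros d)
    ultimately have "ennreal (sum R {..<N}) \<le> (\<Sum>n. ennreal (L n))"
      by (intro LIMSEQ_le_const2) auto
    then show "(\<Sum>n<N. ennreal (R n)) \<le> (\<Sum>n. ennreal (L n))"
      using R by (simp add: sum_ennreal)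
  qed simp
  then show "(\<Sum>n. ennreal ((\<alpha> (Suc n) - \<alpha> n) * d n)) \<le> (\<Sum>n. ennreal ((d n - d (Suc n)) * \<alpha> (Suc n)))"
    by (simp add: L_def R_def)
qed

section \<open>The Choquet norm\<close>

text \<open>Assuming only a diagonalised \<open>cadjoint T \<circ> T\<close> lets the formula serve
  singular systems and diagonal test operators alike.\<close>

lemma choquet_norm_diagonal:
  assumes D: "diagonal e (\<lambda>n. (s n)\<^sup>2) (cadjoint T \<circ> T)" and s: "\<And>n. 0 \<le> s n"
    and p: "p > 0" and \<alpha>: "mono \<alpha>" "\<alpha> 0 = 0"
  shows "choquet_norm \<alpha> p T =
    ennreal_powr (\<Sum>n. ennreal ((\<alpha> (Suc n) - \<alpha> n) * s n powr p)) (1 / p)"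
proof -
  note sv = eigval_seq_op_powr_abs[OF D s p]
  have "decseq (\<lambda>n. s n powr p)"
    using sv(2) s p by (simp add: decseq_def powr_mono2)
  moreover have "(\<lambda>n. s n powr p) \<longlonglongrightarrow> 0"
    by (rule tendsto_zero_powrI[OF sv(3) tendsto_const]) (simp_all add: s p)
  ultimately show ?thesis
    using suminf_abel_summation[OF \<alpha>, of "\<lambda>n. s n powr p"]
    by (simp add: choquet_norm_def choquet_trace_def sv(1))
qed

lemma ennreal_powr_ennreal: "0 \<le> x \<Longrightarrow> ennreal_powr (ennreal x) r = ennreal (x powr r)"
  by (simp add: ennreal_powr_def)

lemma ennreal_powr_top: "ennreal_powr top r = top"
  by (simp add: ennreal_powr_def)

lemma choquet_norm_triangle:
  fixes a b :: "'a::complex_hilbert_space \<Rightarrow> 'a"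
  assumes inf: "\<not> (\<exists>B::'a set. finite B \<and> cvec.span B = UNIV)"
    and p: "p \<ge> 1" and \<alpha>: "mono \<alpha>" "\<alpha> 0 = 0"
    and dec: "decseq (\<lambda>n. \<alpha> (Suc n) - \<alpha> n)"
    and a: "compact_operator a" and b: "compact_operator b"
  shows "choquet_norm \<alpha> p (\<lambda>x. a x + b x) \<le> choquet_norm \<alpha> p a + choquet_norm \<alpha> p b"
proof -
  define w where "w n = \<alpha> (Suc n) - \<alpha> n" for n
  have w: "decseq w" "0 \<le> w n" for n
    using dec monoD[OF \<alpha>(1), of n "Suc n"] by (simp_all add: w_def[abs_def])
  define F where "F s N = (\<Sum>n<N. w n * s n powr p)" for s :: "nat \<Rightarrow> real" and N
  define S where "S s = (\<Sum>n. ennreal (w n * s n powr p))" for s :: "nat \<Rightarrow> real"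
  have F_S: "ennreal (F s N) \<le> S s" for s N
  proof -
    have "(\<Sum>n<N. ennreal (w n * s n powr p)) \<le> S s"
      unfolding S_def by (rule sum_le_suminf) auto
    then show ?thesis using w(2) by (simp add: F_def sum_ennreal)
  qed
  have F_nonneg: "0 \<le> F s N" for s N
    unfolding F_def by (intro sum_nonneg mult_nonneg_nonneg w) simp
  note ab = compact_operator_plus[OF a b]
  obtain ea sa where sa: "singular_system a ea sa" using singular_system_exists[OF inf a] .
  obtain eb sb where sb: "singular_system b eb sb" using singular_system_exists[OF inf b] .
  obtain e s where s: "singular_system (\<lambda>x. a x + b x) e s" using singular_system_exists[OF inf ab] .
  have norm_eq: "choquet_norm \<alpha> p T = ennreal_powr (S t) (1 / p)"
    if "singular_system T f t" "compact_operator T" for T :: "'a \<Rightarrow> 'a" and f t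
    unfolding S_def w_def using that p
    by (intro choquet_norm_diagonal[OF diagonal_cadjoint_comp _ _ \<alpha>])
      (auto simp: singular_system_def)
  show ?thesis
  proof (cases "S sa = top \<or> S sb = top")
    case True
    then show ?thesis
      by (auto simp: norm_eq[OF sa a] norm_eq[OF sb b] ennreal_powr_top)
  next
    case False
    then obtain A B where A: "S sa = ennreal A" "0 \<le> A" and B: "S sb = ennreal B" "0 \<le> B"
      by (metis ennreal_cases)
    define C where "C = A powr (1 / p) + B powr (1 / p)"
    have C: "0 \<le> C" by (simp add: C_def)
    \<comment> \<open>Working with partial sums keeps every quantity real: Ky Fan majorisation, then
      Minkowski, then comparison with the full sums \<open>A\<close> and \<open>B\<close>. As the
      bound does not depend on \<open>N\<close>, it also shows that \<open>S s\<close> is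
      finite.\<close>
    have bound: "F s N \<le> C powr p" for N
    proof -
      have "F s N \<le> (\<Sum>n<N. w n * (sa n + sb n) powr p)"
        unfolding F_def
        by (rule weak_majorization_powr)
          (use s sa sb w p ky_fan_triangle[OF sa a sb b s] in \<open>auto simp: singular_system_def\<close>)
      then have "F s N powr (1 / p) \<le> (\<Sum>n<N. w n * (sa n + sb n) powr p) powr (1 / p)"
        using p F_nonneg by (intro powr_mono2) auto
      also have "\<dots> \<le> F sa N powr (1 / p) + F sb N powr (1 / p)"
        unfolding F_def
        by (rule minkowski_weighted_sum) (use sa sb w p in \<open>auto simp: singular_system_def\<close>)
      also have "\<dots> \<le> C"
        unfolding C_def using F_S[of sa N] F_S[of sb N] A B p F_nonneg
        by (intro add_mono powr_mono2) auto
      finally have "(F s N powr (1 / p)) powr p \<le> C powr p"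
        using p by (intro powr_mono2) auto
      then show ?thesis using p F_nonneg by (simp add: powr_powr)
    qed
    have "S s \<le> ennreal (C powr p)"
      unfolding S_def
    proof (rule suminf_le_const)
      show "(\<Sum>n<N. ennreal (w n * s n powr p)) \<le> ennreal (C powr p)" for N
        using bound[of N] w(2) by (simp add: F_def sum_ennreal ennreal_leI)
    qed simp
    then obtain D where D: "S s = ennreal D" "0 \<le> D" "D \<le> C powr p"
      by (metis ennreal_cases ennreal_le_iff neq_top_trans ennreal_neq_top powr_ge_zero)
    have "D powr (1 / p) \<le> (C powr p) powr (1 / p)"
      using D p by (intro powr_mono2) auto
    then have "D powr (1 / p) \<le> A powr (1 / p) + B powr (1 / p)"
      using C p by (simp add: powr_powr C_def)
    then show ?thesis
      by (simp add: norm_eq[OF s ab] norm_eq[OF sa a] norm_eq[OF sb b] A B D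
          ennreal_powr_ennreal ennreal_leI flip: ennreal_plus)
  qed
qed

section \<open>Finite diagonal test operators and the converse implication\<close>

definition diag_op ::
    "(nat \<Rightarrow> 'a::complex_hilbert_space) \<Rightarrow> (nat \<Rightarrow> real) \<Rightarrow> nat \<Rightarrow> 'a \<Rightarrow> 'a" where
  "diag_op e d N x = (\<Sum>n<N. (d n * cinner x (e n)) *\<^sub>C e n)"

text \<open>The unit ball is sent into the continuous image of a closed disc of scalars, which is
  compact.\<close>

lemma compact_operator_rank_one: "compact_operator (\<lambda>x. (c * cinner x u) *\<^sub>C u)"
proof (rule compact_operatorI_subset)
  show "(\<lambda>x. (c * cinner x u) *\<^sub>C u) ` cball 0 1 \<subseteq> (\<lambda>z. z *\<^sub>C u) ` cball 0 (cmod c * norm u)"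
  proof (rule image_subsetI)
    fix x :: 'a assume "x \<in> cball 0 1"
    then have "norm x * norm u \<le> norm u" by (simp add: mult_left_le_one_le)
    with cinner_cauchy_schwarz[of x u] have "cmod (c * cinner x u) \<le> cmod c * norm u"
      by (simp add: norm_mult mult_left_mono)
    then show "(c * cinner x u) *\<^sub>C u \<in> (\<lambda>z. z *\<^sub>C u) ` cball 0 (cmod c * norm u)"
      by auto
  qed
  show "compact ((\<lambda>z. z *\<^sub>C u) ` cball 0 (cmod c * norm u))"
    by (intro compact_continuous_image compact_cball linear_continuous_on bounded_linear_scaleC_left)
qed (simp_all add: cinner_add_left cinner_scaleC_left distrib_left scaleC_add_left scaleC_scaleC mult_ac)

lemma compact_operator_diag_op: "compact_operator (diag_op e d N)"
proof (induction N)
  case 0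
  show ?case
    using compact_operator_rank_one[of 0 0] by (simp add: diag_op_def[abs_def])
next
  case (Suc N)
  have "compact_operator (\<lambda>x. diag_op e d N x + (d N * cinner x (e N)) *\<^sub>C e N)"
    by (rule compact_operator_plus[OF Suc compact_operator_rank_one])
  then show ?case by (simp add: diag_op_def[abs_def])
qed

text \<open>Real entries make the operator its own adjoint, whence the squares. As \<open>d\<close>
  vanishes from \<open>N\<close> on, \<open>d n\<close> is the right coefficient at every
  index.\<close>

lemma diagonal_diag_op:
  assumes e: "orthonormal e" and d: "decseq d" "\<And>n. 0 \<le> d n" "\<And>n. n \<ge> N \<Longrightarrow> d n = 0"
  shows "diagonal e (\<lambda>n. (d n)\<^sup>2) (cadjoint (diag_op e d N) \<circ> diag_op e d N)"
proof -
  let ?D = "diag_op e d N"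
  have coeff: "cinner (?D x) (e n) = d n * cinner x (e n)" for x n
    using d(3)[of n] by (auto simp: diag_op_def cinner_sum_orthonormal[OF e])
  have "cinner (?D x) y = cinner x (?D y)" for x y
    by (auto simp: diag_op_def cinner_sum_left cinner_sum_right cinner_scaleC_left
        cinner_scaleC_right cinner_commute[of _ y] intro!: sum.cong)
  then have adj: "cadjoint ?D = ?D" by (rule cadjoint_eqI)
  have "\<forall>\<^sub>F n in sequentially. (d n)\<^sup>2 = 0"
    using d(3) by (auto simp: eventually_sequentially)
  then have "(\<lambda>n. (d n)\<^sup>2) \<longlonglongrightarrow> 0" by (rule tendsto_eventually)
  moreover have "cinner (?D x) y = 0" if "\<And>n. cinner y (e n) = 0" for x y
  proof -
    have "cinner (e n) y = 0" for n using that cinner_eq_0_commute by blast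
    then show ?thesis by (simp add: diag_op_def cinner_sum_left cinner_scaleC_left)
  qed
  ultimately show ?thesis
    unfolding diagonal_def adj using e d(1,2)
    by (auto simp: coeff power2_eq_square decseq_def intro!: mult_mono)
qed

lemma choquet_norm_diag_op:
  assumes e: "orthonormal e" and d: "decseq d" "\<And>n. 0 \<le> d n" "\<And>n. n \<ge> N \<Longrightarrow> d n = 0"
    and p: "p > 0" and \<alpha>: "mono \<alpha>" "\<alpha> 0 = 0"
  shows "choquet_norm \<alpha> p (diag_op e d N) =
    ennreal ((\<Sum>n<N. (\<alpha> (Suc n) - \<alpha> n) * d n powr p) powr (1 / p))"
proof -
  have nonneg: "0 \<le> (\<alpha> (Suc n) - \<alpha> n) * d n powr p" for n
    using monoD[OF \<alpha>(1), of n "Suc n"] by simp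
  have "(\<Sum>n. ennreal ((\<alpha> (Suc n) - \<alpha> n) * d n powr p)) =
      (\<Sum>n<N. ennreal ((\<alpha> (Suc n) - \<alpha> n) * d n powr p))"
    using d(3) p by (intro suminf_finite) auto
  also have "\<dots> = ennreal (\<Sum>n<N. (\<alpha> (Suc n) - \<alpha> n) * d n powr p)"
    using nonneg by (simp add: sum_ennreal)
  finally show ?thesis
    using nonneg by (simp add: choquet_norm_diagonal[OF diagonal_diag_op[OF e d] d(2) p \<alpha>]
        ennreal_powr_ennreal sum_nonneg)
qed

text \<open>First-order comparison at \<open>\<epsilon> = 0\<close>, where both sides agree.\<close>

lemma le_if_powr_perturbation:
  fixes x y p :: real
  assumes p: "p > 0"
    and le: "\<And>\<epsilon>. 0 < \<epsilon> \<Longrightarrow> \<epsilon> < 1 \<Longrightarrow> (1 - \<epsilon> / 2) powr p * (x + y) \<le> x + y * (1 - \<epsilon>) powr p"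
  shows "y \<le> x"
proof (rule ccontr)
  assume "\<not> y \<le> x"
  \<comment> \<open>A negative derivative \<open>p * (x - y) / 2\<close> at \<open>0\<close> would
    make \<open>g\<close> negative just to the right, while \<open>le\<close> says that it is
    nonnegative there.\<close>
  define g where "g \<epsilon> = x + y * (1 - \<epsilon>) powr p - (1 - \<epsilon> / 2) powr p * (x + y)" for \<epsilon>
  have "(g has_real_derivative p * (x - y) / 2) (at 0)"
    unfolding g_def by (auto intro!: derivative_eq_intros simp: field_simps)
  moreover have "p * (x - y) / 2 < 0"
    using p \<open>\<not> y \<le> x\<close> by (simp add: mult_pos_neg)
  ultimately obtain \<delta> where \<delta>: "\<delta> > 0" "\<And>h. 0 < h \<Longrightarrow> h < \<delta> \<Longrightarrow> g (0 + h) < g 0"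
    using DERIV_neg_dec_right by metis
  define h where "h = min (\<delta> / 2) (1 / 2)"
  have h: "0 < h" "h < \<delta>" "h < 1" using \<delta>(1) by (auto simp: h_def)
  show False
    using \<delta>(2)[OF h(1,2)] le[OF h(1,3)] by (simp add: g_def)
qed

text \<open>The test operators are \<open>diag(1, \<dots>, 1, 1, 1 - \<epsilon>)\<close> and \<open>diag(1, \<dots>, 1, 1 - \<epsilon>, 1)\<close>. For \<open>p > 1\<close>
  projections (\<open>\<epsilon> = 1\<close>) give too weak an inequality, so \<open>\<epsilon>\<close> has to tend to \<open>0\<close>.\<close>

lemma choquet_increment_decreasing:
  assumes inf: "\<not> (\<exists>B::'a::complex_hilbert_space set. finite B \<and> cvec.span B = UNIV)"
    and p: "p \<ge> 1" and \<alpha>: "mono \<alpha>" "\<alpha> 0 = 0"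
    and tri: "\<And>a b :: 'a \<Rightarrow> 'a. compact_operator a \<Longrightarrow> compact_operator b \<Longrightarrow>
        choquet_norm \<alpha> p (\<lambda>x. a x + b x) \<le> choquet_norm \<alpha> p a + choquet_norm \<alpha> p b"
  shows "\<alpha> (Suc (Suc k)) - \<alpha> (Suc k) \<le> \<alpha> (Suc k) - \<alpha> k"
proof -
  define w where "w n = \<alpha> (Suc n) - \<alpha> n" for n
  \<comment> \<open>A singular system of the zero operator supplies an infinite orthonormal
    sequence.\<close>
  obtain e :: "nat \<Rightarrow> 'a" and s where "singular_system (diag_op (\<lambda>_. 0) (\<lambda>_. 0) 0) e s"
    using singular_system_exists[OF inf compact_operator_diag_op] .
  then have e: "orthonormal e" by (simp add: singular_system_def)
  define \<pi> where "\<pi> = Transposition.transpose k (Suc k)"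
  have \<pi>: "bij_betw \<pi> {..<Suc (Suc k)} {..<Suc (Suc k)}" "inj \<pi>" "\<And>n. \<pi> (\<pi> n) = n"
    by (auto simp: \<pi>_def intro!: bij_betw_byWitness[where f' = \<pi>])
  have e\<pi>: "orthonormal (e \<circ> \<pi>)" by (rule orthonormal_compose[OF e \<pi>(2)])
  have "w (Suc k) \<le> w k"
  proof (rule le_if_powr_perturbation)
    fix \<epsilon> :: real assume \<epsilon>: "0 < \<epsilon>" "\<epsilon> < 1"
    \<comment> \<open>Counting from \<open>0\<close>, \<open>d\<close> starts with
      \<open>k + 1\<close> ones. Adding \<open>d\<close> and its swapped copy gives \<open>k\<close>
      entries \<open>2\<close> and two equal entries \<open>2 - \<epsilon>\<close>, which is
      \<open>d'\<close>.\<close>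
    define d where "d n = (if n \<le> k then 1 else if n = Suc k then 1 - \<epsilon> else 0)" for n
    define d' where "d' n = (if n < k then 2 else if n \<le> Suc k then 2 - \<epsilon> else 0)" for n
    have d: "decseq d" "\<And>n. 0 \<le> d n" "\<And>n. n \<ge> Suc (Suc k) \<Longrightarrow> d n = 0"
      using \<epsilon> by (auto simp: d_def decseq_def)
    have d': "decseq d'" "\<And>n. 0 \<le> d' n" "\<And>n. n \<ge> Suc (Suc k) \<Longrightarrow> d' n = 0"
      using \<epsilon> by (auto simp: d'_def decseq_def)
    let ?a = "diag_op e d (Suc (Suc k))" and ?b = "diag_op (e \<circ> \<pi>) d (Suc (Suc k))"
    \<comment> \<open>Over the permuted basis the entries of \<open>?b\<close> are decreasing, as
      the norm formula demands; rewriting them over \<open>e\<close> allows the addition to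
      \<open>?a\<close>.\<close>
    have "?b x = (\<Sum>n<Suc (Suc k). (d (\<pi> n) * cinner x (e n)) *\<^sub>C e n)" for x
      unfolding diag_op_def
      by (rule sum.reindex_bij_betw[OF \<pi>(1), symmetric, THEN trans]) (simp add: \<pi>(3))
    then have "?a x + ?b x = (\<Sum>n<Suc (Suc k). ((d n + d (\<pi> n)) * cinner x (e n)) *\<^sub>C e n)" for x
      by (simp add: diag_op_def distrib_right scaleC_add_left sum.distrib)
    also have "(\<Sum>n<Suc (Suc k). ((d n + d (\<pi> n)) * cinner x (e n)) *\<^sub>C e n) =
        diag_op e d' (Suc (Suc k)) x" for x
      unfolding diag_op_def
    proof (rule sum.cong)
      fix n assume "n \<in> {..<Suc (Suc k)}"
      then have "d n + d (\<pi> n) = d' n"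
        by (auto simp: d_def d'_def \<pi>_def Transposition.transpose_def)
      then show "((d n + d (\<pi> n)) * cinner x (e n)) *\<^sub>C e n = (d' n * cinner x (e n)) *\<^sub>C e n"
        by (metis of_real_add)
    qed simp
    finally have sum: "(\<lambda>x. ?a x + ?b x) = diag_op e d' (Suc (Suc k))" by blast
    define V where "V = (\<Sum>n<Suc (Suc k). w n * d n powr p)"
    define V' where "V' = (\<Sum>n<Suc (Suc k). w n * d' n powr p)"
    have w: "0 \<le> w n" for n using monoD[OF \<alpha>(1), of n "Suc n"] by (simp add: w_def)
    have V: "0 \<le> V" "0 \<le> V'"
      unfolding V_def V'_def by (intro sum_nonneg mult_nonneg_nonneg w powr_ge_zero)+
    have p0: "p > 0" using p by simp
    have "choquet_norm \<alpha> p (diag_op e d' (Suc (Suc k))) \<le> choquet_norm \<alpha> p ?a + choquet_norm \<alpha> p ?b"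
      using tri[OF compact_operator_diag_op compact_operator_diag_op] unfolding sum[symmetric] .
    then have "ennreal (V' powr (1 / p)) \<le> ennreal (V powr (1 / p)) + ennreal (V powr (1 / p))"
      by (simp only: choquet_norm_diag_op[OF e d p0 \<alpha>] choquet_norm_diag_op[OF e d' p0 \<alpha>]
          choquet_norm_diag_op[OF e\<pi> d p0 \<alpha>] V_def V'_def w_def)
    then have "V' powr (1 / p) \<le> 2 * V powr (1 / p)"
      by (simp flip: ennreal_plus)
    then have "(V' powr (1 / p)) powr p \<le> (2 * V powr (1 / p)) powr p"
      using p by (intro powr_mono2) auto
    then have le: "V' \<le> 2 powr p * V"
      using p V by (simp add: powr_powr powr_mult)
    have w_sum: "(\<Sum>n<N. w n) = \<alpha> N" for N
      by (induction N) (simp_all add: w_def \<alpha>(2))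
    have "V = \<alpha> k + w k + w (Suc k) * (1 - \<epsilon>) powr p"
      by (simp add: V_def d_def w_sum)
    moreover have "V' = 2 powr p * \<alpha> k + (2 - \<epsilon>) powr p * (w k + w (Suc k))"
      using w_sum[of k] by (simp add: V'_def d'_def algebra_simps flip: sum_distrib_right)
    moreover have "(2 - \<epsilon>) powr p = 2 powr p * (1 - \<epsilon> / 2) powr p"
      using \<epsilon> by (simp flip: powr_mult)
    \<comment> \<open>The first \<open>k\<close> entries contribute
      \<open>2 powr p * \<alpha> k\<close> to both sides of \<open>le\<close> and cancel, leaving
      positions \<open>k\<close> and \<open>Suc k\<close>.\<close>
    ultimately have "2 powr p * ((1 - \<epsilon> / 2) powr p * (w k + w (Suc k))) \<le>
        2 powr p * (w k + w (Suc k) * (1 - \<epsilon>) powr p)"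
      using le by (simp add: algebra_simps)
    then show "(1 - \<epsilon> / 2) powr p * (w k + w (Suc k)) \<le> w k + w (Suc k) * (1 - \<epsilon>) powr p"
      by simp
  qed (use p in simp)
  then show ?thesis by (simp add: w_def)
qed

theorem theorem4p7:
  fixes p :: real and \<alpha> c :: "nat \<Rightarrow> real"
  assumes "separable_space (euclidean :: 'a::complex_hilbert_space topology)"
    and "\<not> (\<exists>B::'a set. finite B \<and> cvec.span B = UNIV)"
    and "p \<ge> 1"
    and "\<And>i. \<alpha> i \<ge> 0" and "mono \<alpha>" and "\<alpha> 0 = 0" and "\<alpha> 1 > 0"
    and "\<And>i. i \<ge> 1 \<Longrightarrow> c i = \<alpha> i - \<alpha> (i - 1)"
  shows "((\<forall>i\<ge>1. (\<alpha> (i + 1) + \<alpha> (i - 1)) / 2 \<le> \<alpha> i) \<longleftrightarrow> antimono_on {1..} c) \<and>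
    (antimono_on {1..} c \<longleftrightarrow>
      (\<forall>a b :: 'a \<Rightarrow> 'a. compact_operator a \<longrightarrow> compact_operator b \<longrightarrow>
        choquet_norm \<alpha> p (\<lambda>x. a x + b x) \<le> choquet_norm \<alpha> p a + choquet_norm \<alpha> p b))"
proof -
  have c: "c (Suc n) = \<alpha> (Suc n) - \<alpha> n" for n
    using assms(8)[of "Suc n"] by simp
  \<comment> \<open>An index shift: \<open>c\<close> counts from \<open>1\<close>, the sequence of
    increments from \<open>0\<close>.\<close>
  have anti: "antimono_on {1..} c \<longleftrightarrow> decseq (\<lambda>n. \<alpha> (Suc n) - \<alpha> n)"
  proof
    assume "antimono_on {1..} c"
    then show "decseq (\<lambda>n. \<alpha> (Suc n) - \<alpha> n)"
      unfolding decseq_def c[symmetric] by (auto simp: monotone_on_def)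
  next
    assume dec: "decseq (\<lambda>n. \<alpha> (Suc n) - \<alpha> n)"
    show "antimono_on {1..} c"
    proof (rule monotone_onI)
      fix i j :: nat assume "i \<in> {1..}" "j \<in> {1..}" "i \<le> j"
      then obtain m n where "i = Suc m" "j = Suc n" "m \<le> n"
        by (cases i; cases j) auto
      then show "c j \<le> c i" using decseqD[OF dec, of m n] by (simp add: c)
    qed
  qed
  have step: "decseq (\<lambda>n. \<alpha> (Suc n) - \<alpha> n) \<longleftrightarrow>
      (\<forall>k. \<alpha> (Suc (Suc k)) - \<alpha> (Suc k) \<le> \<alpha> (Suc k) - \<alpha> k)"
    by (simp add: decseq_Suc_iff)
  \<comment> \<open>Writing \<open>i\<close> as \<open>Suc k\<close> removes the truncated
    subtraction.\<close>
  have "(\<forall>i\<ge>1. (\<alpha> (i + 1) + \<alpha> (i - 1)) / 2 \<le> \<alpha> i) \<longleftrightarrow>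
      (\<forall>k. (\<alpha> (Suc (Suc k)) + \<alpha> k) / 2 \<le> \<alpha> (Suc k))"
    by (metis Suc_eq_plus1 Suc_le_D One_nat_def diff_Suc_1 le_add2)
  also have "\<dots> \<longleftrightarrow> (\<forall>k. \<alpha> (Suc (Suc k)) - \<alpha> (Suc k) \<le> \<alpha> (Suc k) - \<alpha> k)"
    by (simp add: field_simps)
  finally have "(\<forall>i\<ge>1. (\<alpha> (i + 1) + \<alpha> (i - 1)) / 2 \<le> \<alpha> i) \<longleftrightarrow> antimono_on {1..} c"
    by (simp only: anti step)
  moreover have "antimono_on {1..} c \<longleftrightarrow>
      (\<forall>a b :: 'a \<Rightarrow> 'a. compact_operator a \<longrightarrow> compact_operator b \<longrightarrow>
        choquet_norm \<alpha> p (\<lambda>x. a x + b x) \<le> choquet_norm \<alpha> p a + choquet_norm \<alpha> p b)"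
    using choquet_norm_triangle[OF assms(2,3,5,6)] choquet_increment_decreasing[OF assms(2,3,5,6)]
    unfolding anti by (metis step)
  ultimately show ?thesis by blast
qed

end
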